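(* Fix $m\in\mathbb{N}$. 1. Fix $d\in\mathbb{R}$. Let $(n_j)_j$ be an increasing sequence of integers with $n_j\ge 2$ and let $(d_j)_j$ be a sequence of real numbers such that $\lim_{j\to\infty}d_j=d$ and $$k_j=e\log n_j+\left((e-1)(m-1)-\tfrac{1}{2}\right)\log\log n_j+d_j\in\mathbb{N}\quad\text{for all } j\in\mathbb{N}.$$ Then, as $j\to\infty$, the joint probability distribution of $$\left(\frac{T_m(n_j)-n_j\log n_j-(m-1)n_j\log\log n_j}{n_j},\ S_{k_j}\right),$$ where $S_{k_j}$ is the number of $k_j$-tons in the collection process with $n_j$ types of coupons, converges to $\left(X,\mathrm{Pois}\left(\frac{e^{(e-1)X-d}}{\sqrt{2\pi e}}\right)\right)$, where $X\sim\mathrm{Gumbel}(-\log((m-1)!),1)$; that is, to the distribution of a random vector $(X,Y)$ such that $X\sim\mathrm{Gumbel}(-\log((m-1)!),1)$ and, conditionally on $X$, $Y$ has the Poisson distribution with mean $\frac{e^{(e-1)X-d}}{\sqrt{2\pi e}}$. 2. Let $g$ be a real-valued function on the integers $n\ge 2$ with $g(n)=o(\log\log n)$ as $n\to\infty$ and $\lim_{n\to\infty}g(n)=\infty$, such that $$k=k(n)=e\log n+\left((e-1)(m-1)-\tfrac{1}{2}\right)\log\log n+g(n)\in\mathbb{N}\quad\text{for all } n\ge 2.$$ Then, as $n\to\infty$, $S_k$ converges to $0$ with probability $1$. 3. Let $g$ be a real-valued function on the integers $n\ge 2$ with $g(n)=o(\log\log n)$ as $n\to\infty$ and $\lim_{n\to\infty}g(n)=\infty$,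 such that $$k=k(n)=e\log n+\left((e-1)(m-1)-\tfrac{1}{2}\right)\log\log n-g(n)\in\mathbb{N}\quad\text{for all } n\ge 2.$$ Then, as $n\to\infty$, the value of $P(S_k=0)$ converges to $0$.
   Context: Coupon collector problem: there are $n$ types of coupons. Coupons are collected one at a time; each collected coupon is, independently of the others, of each given type with probability $1/n$. Fix a positive integer $m$. One keeps collecting until at least $m$ copies of every one of the $n$ types have been collected, and then stops. $T_m(n)$ denotes the total number of coupons collected at the stopping time. For an integer $k\ge m$, a type of coupon is called a $k$-ton if exactly $k$ copies of it have been collected at the stopping time, and $S_k$ (which depends on $n$ and $m$) denotes the number of types that are $k$-tons. (The assertions are limits, so only large indices matter, for which the values of $k$ considered are at least $m$.) $\mathbb{N}$ denotes the positive integers, $\log$ the natural logarithm, and $e$ the base of the natural logarithm. $\mathrm{Gumbel}(\mu,\beta)$ denotes the probability distribution on $\mathbb{R}$ with cumulative distribution function $x\mapsto e^{-e^{-(x-\mu)/\beta}}$. $\mathrm{Pois}(\lambda)$ denotes the Poisson distribution with mean $\lambda$.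
   Formalization: In part 2, "S_k converges to 0 with probability 1" is stated as P(S_k=0) → 1: no coupling of the processes for different n is given, and almost-sure convergence fails for independent processes with slowly growing g. *)

theory Defs
  imports "HOL-Probability.Probability" "HOL-Library.Landau_Symbols"
begin

section \<open>The coupon collection process\<close>

text \<open>
  The \<open>n\<close> types are \<open>0, \<dots>, n - 1\<close>, and \<open>X i\<close> is the type of the coupon drawn at time
  \<open>i = 0, 1, 2, \<dots>\<close>. In the theorem there is one such process for every \<open>n\<close>, on its own
  probability space; nothing is assumed about how processes for different \<open>n\<close> are related.
\<close>

definition coupon_process :: "'a measure \<Rightarrow> nat \<Rightarrow> (nat \<Rightarrow> 'a \<Rightarrow> nat) \<Rightarrow> bool" where
  "coupon_process M n X \<longleftrightarrow>
     prob_space M \<and>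
     prob_space.indep_vars M (\<lambda>_. count_space UNIV) X UNIV \<and>
     (\<forall>i. distr M (count_space UNIV) (X i) = measure_pmf (pmf_of_set {..<n}))"

definition copies :: "(nat \<Rightarrow> 'a \<Rightarrow> nat) \<Rightarrow> nat \<Rightarrow> nat \<Rightarrow> 'a \<Rightarrow> nat" where
  "copies X t c \<omega> = card {i. i < t \<and> X i \<omega> = c}"

text \<open>
  On the null event that the collection never terminates, \<open>LEAST\<close> yields some fixed
  unspecified number.
\<close>

definition stop_time :: "nat \<Rightarrow> nat \<Rightarrow> (nat \<Rightarrow> 'a \<Rightarrow> nat) \<Rightarrow> 'a \<Rightarrow> nat" where
  "stop_time m n X \<omega> = (LEAST t. \<forall>c<n. m \<le> copies X t c \<omega>)"

definition num_tons :: "nat \<Rightarrow> nat \<Rightarrow> (nat \<Rightarrow> 'a \<Rightarrow> nat) \<Rightarrow> nat \<Rightarrow> 'a \<Rightarrow> nat" where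
  "num_tons m n X k \<omega> = card {c. c < n \<and> copies X (stop_time m n X \<omega>) c \<omega> = k}"

section \<open>Limit laws\<close>

definition weakly_converges ::
    "(nat \<Rightarrow> 'a::topological_space measure) \<Rightarrow> 'a measure \<Rightarrow> bool" where
  "weakly_converges \<mu> \<nu> \<longleftrightarrow>
     (\<forall>f :: 'a \<Rightarrow> real. continuous_on UNIV f \<longrightarrow> bounded (range f) \<longrightarrow>
        (\<lambda>j. integral\<^sup>L (\<mu> j) f) \<longlonglongrightarrow> integral\<^sup>L \<nu> f)"

definition gumbel :: "real \<Rightarrow> real \<Rightarrow> real measure" where
  "gumbel \<mu> \<beta> = interval_measure (\<lambda>x. exp (- exp (- (x - \<mu>) / \<beta>)))"

text \<open>
  The law on \<open>\<real>\<^sup>2\<close> of a random vector \<open>(X, Y)\<close> such that \<open>X\<close> has law \<open>\<mu>\<close> and, conditionally on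
  \<open>X\<close>, \<open>Y\<close> has the Poisson distribution with mean \<open>r X\<close>, where \<open>r\<close> is positive and Borel.
\<close>

definition mixed_poisson :: "real measure \<Rightarrow> (real \<Rightarrow> real) \<Rightarrow> (real \<times> real) measure" where
  "mixed_poisson \<mu> r =
     \<mu> \<bind> (\<lambda>x. distr (measure_pmf (poisson_pmf (r x))) borel (\<lambda>y. (x, real y)))"

lemma
  fixes \<mu> \<beta> :: real
  assumes "\<beta> > 0"
  shows real_distribution_gumbel: "real_distribution (gumbel \<mu> \<beta>)"
    and cdf_gumbel: "cdf (gumbel \<mu> \<beta>) = (\<lambda>x. exp (- exp (- (x - \<mu>) / \<beta>)))"
proof -
  let ?F = "\<lambda>x. exp (- exp (- (x - \<mu>) / \<beta>))"
  have mono: "?F x \<le> ?F y" if "x \<le> y" for x y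
    using that assms by (simp add: divide_right_mono)
  have cont: "continuous (at_right a) ?F" for a
    using assms by (intro continuous_intros) auto
  have bot: "(?F \<longlongrightarrow> 0) at_bot"
    using assms by real_asymp
  have top: "(?F \<longlongrightarrow> 1) at_top"
    using assms by real_asymp
  show "real_distribution (gumbel \<mu> \<beta>)"
    unfolding gumbel_def by (rule real_distribution_interval_measure[OF mono cont bot top])
  show "cdf (gumbel \<mu> \<beta>) = ?F"
    unfolding gumbel_def by (rule cdf_interval_measure[OF mono cont bot])
qed

lemma mixed_poisson_kernel:
  fixes r :: "real \<Rightarrow> real"
  assumes [measurable]: "r \<in> borel_measurable borel" and pos: "\<And>x. r x > 0"
  shows "(\<lambda>x. distr (measure_pmf (poisson_pmf (r x))) borel (\<lambda>y. (x, real y)))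
           \<in> borel \<rightarrow>\<^sub>M subprob_algebra borel"
proof (rule measurable_subprob_algebra)
  fix x :: real
  show "subprob_space (distr (measure_pmf (poisson_pmf (r x))) borel (\<lambda>y. (x, real y)))"
    by (intro prob_space_imp_subprob_space prob_space.prob_space_distr prob_space_measure_pmf) auto
next
  fix A :: "(real \<times> real) set"
  assume [measurable]: "A \<in> sets borel"
  have [measurable]: "(\<lambda>x. indicator A (x, real y) :: ennreal) \<in> borel_measurable borel" for y
    by (rule measurable_compose[of "\<lambda>x. (x, real y)" _ borel]) (auto intro!: borel_measurable_Pair)
  have "emeasure (distr (measure_pmf (poisson_pmf (r x))) borel (\<lambda>y. (x, real y))) A =
      (\<Sum>y. ennreal (r x ^ y / fact y * exp (- r x)) * indicator A (x, real y))" for x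
  proof -
    have "emeasure (distr (measure_pmf (poisson_pmf (r x))) borel (\<lambda>y. (x, real y))) A =
        (\<integral>\<^sup>+ z. indicator A z \<partial>distr (measure_pmf (poisson_pmf (r x))) borel (\<lambda>y. (x, real y)))"
      by simp
    also have "\<dots> = (\<integral>\<^sup>+ y. indicator A (x, real y) \<partial>measure_pmf (poisson_pmf (r x)))"
      by (subst nn_integral_distr) auto
    also have "\<dots> = (\<Sum>y. ennreal (r x ^ y / fact y * exp (- r x)) * indicator A (x, real y))"
      by (simp add: nn_integral_measure_pmf nn_integral_count_space_nat pos)
    finally show ?thesis .
  qed
  then show "(\<lambda>x. emeasure (distr (measure_pmf (poisson_pmf (r x))) borel (\<lambda>y. (x, real y))) A)
      \<in> borel_measurable borel"
    by simp
qed auto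

lemma emeasure_mixed_poisson:
  fixes r :: "real \<Rightarrow> real"
  assumes \<mu>: "real_distribution \<mu>"
    and r: "r \<in> borel_measurable borel" "\<And>x. r x > 0" and A: "A \<in> sets borel"
  shows "emeasure (mixed_poisson \<mu> r) (A \<times> {real y}) =
    (\<integral>\<^sup>+ x. ennreal (pmf (poisson_pmf (r x)) y) * indicator A x \<partial>\<mu>)"
proof -
  interpret real_distribution \<mu> by fact
  have meas: "A \<times> {real y} \<in> sets borel"
    using A by (auto simp: borel_prod[symmetric])
  have "emeasure (mixed_poisson \<mu> r) (A \<times> {real y}) =
      (\<integral>\<^sup>+ x. emeasure (distr (measure_pmf (poisson_pmf (r x))) borel (\<lambda>y. (x, real y)))
         (A \<times> {real y}) \<partial>\<mu>)"
    unfolding mixed_poisson_def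
    by (rule emeasure_bind[where N = borel])
       (use mixed_poisson_kernel[OF r] meas in \<open>auto cong: measurable_cong_sets\<close>)
  also have "\<dots> = (\<integral>\<^sup>+ x. ennreal (pmf (poisson_pmf (r x)) y) * indicator A x \<partial>\<mu>)"
  proof (rule nn_integral_cong)
    fix x
    have "(\<lambda>y. (x, real y)) -` (A \<times> {real y}) = (if x \<in> A then {y} else {})"
      by auto
    then show "emeasure (distr (measure_pmf (poisson_pmf (r x))) borel (\<lambda>y. (x, real y)))
         (A \<times> {real y}) = ennreal (pmf (poisson_pmf (r x)) y) * indicator A x"
      using meas by (subst emeasure_distr) (auto simp: emeasure_pmf_single indicator_def)
  qed
  finally show ?thesis .
qed

end

theory Submission
  imports Defs "HOL-Real_Asymp.Real_Asymp"
begin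

text \<open>
  All three assertions follow from one local limit statement. The collection stops with draw
  \<open>t + 1\<close> exactly if after \<open>t\<close> draws one type has \<open>m - 1\<close> copies, every other type has at least \<open>m\<close>
  copies, and the next coupon is of the first type (\<open>stop_time_completes\<close>). For \<open>k > m\<close> the last coupon
  creates or destroys no \<open>k\<close>-ton, so the joint law of \<open>T\<^sub>m(n)\<close> and \<open>S\<^sub>k\<close> is read off from the counts at
  the fixed time \<open>t\<close>, which are multinomial (\<open>prob_copies_eq\<close>).

  At a time \<open>t = n (log n + (m - 1) log log n + x) + o(n)\<close> finitely many counts are asymptotically
  independent Poisson variables of mean \<open>t / n\<close> (\<open>multinomial_bounds\<close>). The number of types with
  fewer than \<open>m\<close> copies then has mean tending to \<open>\<mu> = exp (-x) / (m - 1)!\<close>, all of it due to types with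
  exactly \<open>m - 1\<close> copies, and the mean number \<open>r\<close> of \<open>k\<close>-tons satisfies, by Stirling's formula,
  \<open>r exp(\<delta>) \<rightarrow> exp ((e - 1) x) / sqrt (2 \<pi> e)\<close>, where \<open>\<delta>\<close> stands for \<open>d\<^sub>j\<close>, \<open>g(n)\<close> or \<open>-g(n)\<close>
  (\<open>critical_window.mean_tons_asymptotics\<close>). Inclusion and exclusion over the types with too few copies
  gives the binomial moments of the number of \<open>k\<close>-tons on the event that draw \<open>t + 1\<close> completes the
  collection: multiplied by \<open>n\<close>, the moment of order \<open>s\<close> is asymptotic to
  \<open>\<mu> exp (-\<mu>) r\<^sup>s / s!\<close> (\<open>ton_moment_limit\<close>).

  If \<open>r\<close> has a limit \<open>\<rho>\<close>, a second inclusion and exclusion shows that \<open>n\<close> times the probability of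
  completing at draw \<open>t + 1\<close> with \<open>s\<close> many \<open>k\<close>-tons tends to the Gumbel density \<open>\<mu> exp (-\<mu>)\<close> at \<open>x\<close> times
  the Poisson weight of \<open>s\<close> for the mean \<open>\<rho>\<close> (\<open>local_limit_bounded\<close>). If \<open>r \<rightarrow> \<infinity>\<close>, a second
  moment bound shows that completion without a \<open>k\<close>-ton is negligible (\<open>local_limit_unbounded\<close>).

  The passage from these local limits to limits of expectations needs lower bounds only. Fatou's lemma
  for the integral over \<open>x\<close> bounds the lower limit of \<open>E f(T, S)\<close> from below by the expectation under
  the limit law (\<open>fatou_local_to_global\<close>); the limit law has total mass 1, so the same bound for
  \<open>B - f\<close>, where \<open>B\<close> bounds \<open>\<bar>f\<bar>\<close>, is the matching upper bound (\<open>weakly_convergesI_liminf\<close>).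
\<close>

section \<open>Stirling's formula\<close>

text \<open>
  The increments are \<open>1 - (n + 1/2) log (1 + 1/n) = O(1/n\<^sup>2)\<close>, hence summable.
\<close>

lemma stirling_convergent:
  "convergent (\<lambda>n. ln (fact (Suc n)) - (real (Suc n) + 1/2) * ln (real (Suc n)) + real (Suc n))"
    (is "convergent ?a")
proof -
  have diff: "?a (Suc n) - ?a n = 1 - (real (Suc n) + 1/2) * ln (1 + 1 / real (Suc n))" for n
  proof -
    have "1 + 1 / real (Suc n) = real (Suc (Suc n)) / real (Suc n)"
      by (simp add: field_simps)
    then have e1: "ln (1 + 1 / real (Suc n)) = ln (real (Suc (Suc n))) - ln (real (Suc n))"
      by (simp add: ln_div del: of_nat_Suc)
    have e2: "ln (fact (Suc (Suc n)) :: real) = ln (real (Suc (Suc n))) + ln (fact (Suc n))"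
      by (subst fact_Suc) (simp add: ln_mult del: fact_Suc of_nat_Suc)
    have "(l1 + f) - (y + 1/2) * l1 + y - (f - (x + 1/2) * l0 + x) = 1 - (x + 1/2) * (l1 - l0)"
      if "y = x + 1" for l0 l1 f x y :: real
      using that by (simp add: field_simps)
    from this[where y = "real (Suc (Suc n))" and x = "real (Suc n)"] show ?thesis
      unfolding e1 e2 by simp
  qed
  have "(\<lambda>n. 1 - (real (Suc n) + 1/2) * ln (1 + 1 / real (Suc n))) \<in> O(\<lambda>n. 1 / real n ^ 2)"
    by real_asymp
  then have "summable (\<lambda>n. ?a (Suc n) - ?a n)"
    unfolding diff
    by (rule summable_comparison_test_bigo[rotated])
       (use inverse_power_summable[of 2, where 'a = real] in \<open>simp add: field_simps\<close>)
  then have "(\<lambda>n. \<Sum>i<n. ?a (Suc i) - ?a i) \<longlonglongrightarrow> suminf (\<lambda>n. ?a (Suc n) - ?a n)"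
    by (rule summable_LIMSEQ)
  also have "(\<lambda>n. \<Sum>i<n. ?a (Suc i) - ?a i) = (\<lambda>n. ?a n - ?a 0)"
    by (rule ext) (rule sum_lessThan_telescope)
  finally have "convergent (\<lambda>n. ?a n - ?a 0)"
    unfolding convergent_def by blast
  then have "convergent (\<lambda>n. (?a n - ?a 0) + ?a 0)"
    by (intro convergent_add convergent_const)
  then show ?thesis by (simp only: diff_add_cancel)
qed

lemma wallis_prod_eq:
  "(\<Prod>k=1..n. (4*real k^2) / (4*real k^2 - 1)) = 2 ^ (4*n) * fact n ^ 4 / ((fact (2*n))\<^sup>2 * (2 * real n + 1))"
proof (induction n)
  case 0 then show ?case by simp
next
  case (Suc n)
  have nz: "4 * (1 + real n)\<^sup>2 - 1 = (2 * real n + 1) * (2 * real n + 3)"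
    by (simp add: power2_eq_square algebra_simps)
  have f: "fact (2 * Suc n) = 2 * (real n + 1) * (2 * real n + 1) * fact (2*n)"
    by (simp add: algebra_simps)
  have "(\<Prod>k=1..Suc n. (4*real k^2) / (4*real k^2 - 1)) =
      (4 * (1 + real n)\<^sup>2) / (4 * (1 + real n)\<^sup>2 - 1) * (\<Prod>k=1..n. (4*real k^2) / (4*real k^2 - 1))"
    by (subst prod.nat_ivl_Suc') auto
  also have "\<dots> = 2 ^ (4 * Suc n) * fact (Suc n) ^ 4 / ((fact (2 * Suc n))\<^sup>2 * (2 * real (Suc n) + 1))"
  proof -
    define F G p :: real where "F = fact n" and "G = fact (2 * n)" and "p = 2 ^ (4 * n)"
    have "G > 0" "fact (Suc n) = (1 + real n) * F" "(2::real) ^ (4 * Suc n) = 16 * p"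
      by (simp_all add: F_def G_def p_def power_add)
    then show ?thesis
      unfolding Suc.IH f nz unfolding F_def[symmetric] G_def[symmetric] p_def[symmetric]
      by (simp add: divide_simps power_mult_distrib add_pos_nonneg) (simp add: power2_eq_square power4_eq_xxxx algebra_simps)
  qed
  finally show ?case .
qed

text \<open>
  By \<open>stirling_convergent\<close> the quotient \<open>a n = n! / (sqrt n (n/e)^n)\<close> has a positive limit. The Wallis
  products are \<open>a n ^ 4 / a (2 n)\<^sup>2\<close> up to a factor tending to \<open>1/4\<close>, so the square of the limit is \<open>2 \<pi>\<close>.
\<close>

lemma stirling: "(\<lambda>n. fact n / (sqrt (2 * pi * n) * (real n / exp 1) ^ n)) \<longlonglongrightarrow> 1"
proof -
  define a where "a n = fact n / (sqrt n * (real n / exp 1) ^ n)" for n :: nat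
  obtain L where L: "(\<lambda>n. ln (fact (Suc n)) - (real (Suc n) + 1/2) * ln (real (Suc n)) + real (Suc n)) \<longlonglongrightarrow> L"
    using stirling_convergent unfolding convergent_def by blast
  have a_exp: "a n = exp (ln (fact n) - (real n + 1/2) * ln (real n) + real n)" if "n > 0" for n
  proof -
    have "ln (sqrt n * (real n / exp 1) ^ n) = (real n + 1/2) * ln (real n) - real n"
      using that by (simp add: ln_mult ln_sqrt ln_realpow ln_div algebra_simps)
    moreover have "sqrt n * (real n / exp 1) ^ n > 0" using that by simp
    ultimately have "sqrt n * (real n / exp 1) ^ n = exp ((real n + 1/2) * ln (real n) - real n)"
      by (metis exp_ln)
    then show ?thesis
      unfolding a_def by (simp add: exp_diff[of "ln (fact n)" "(real n + 1/2) * ln (real n) - real n", symmetric, simplified])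
  qed
  have "(\<lambda>n. a (Suc n)) \<longlonglongrightarrow> exp L"
    using tendsto_exp[OF L] by (subst a_exp) auto
  then have aL: "a \<longlonglongrightarrow> exp L"
    by (rule LIMSEQ_imp_Suc)
  have "(\<lambda>n. a (2*n)) \<longlonglongrightarrow> exp L"
    by (rule filterlim_compose[OF aL]) real_asymp
  then have "(\<lambda>n. (a n ^ 4 / (a (2*n))\<^sup>2) * (real n / (2 * (2 * real n + 1)))) \<longlonglongrightarrow> (exp L ^ 4 / (exp L)\<^sup>2) * (1/4)"
    using aL by (intro tendsto_mult[OF tendsto_divide[OF tendsto_power tendsto_power]]) (auto, real_asymp)
  moreover have "\<forall>\<^sub>F n in sequentially. (a n ^ 4 / (a (2*n))\<^sup>2) * (real n / (2 * (2 * real n + 1)))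
      = (\<Prod>k=1..n. (4*real k^2) / (4*real k^2 - 1))"
    using eventually_gt_at_top[of 0]
  proof eventually_elim
    case (elim n)
    have s: "sqrt (real n) ^ 4 = (real n)\<^sup>2"
      using real_sqrt_pow2[of "real n"] by (metis of_nat_0_le_iff power2_eq_square power4_eq_xxxx mult.assoc)
    have e: "((real (2*n) / exp 1) ^ (2*n))\<^sup>2 = 2 ^ (4*n) * ((real n / exp 1) ^ n) ^ 4"
      by (simp add: power_mult_distrib power_mult[symmetric] power_divide mult.commute)
    have a4: "a n ^ 4 = fact n ^ 4 / ((real n)\<^sup>2 * ((real n / exp 1) ^ n) ^ 4)"
      unfolding a_def by (simp add: power_divide power_mult_distrib s)
    have a2: "(a (2*n))\<^sup>2 = (fact (2*n))\<^sup>2 / (2 * real n * (2 ^ (4*n) * ((real n / exp 1) ^ n) ^ 4))"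
      unfolding a_def e[symmetric] by (simp add: power_divide power_mult_distrib)
    have "F ^ 4 / (x\<^sup>2 * P) / (G\<^sup>2 / (2 * x * (p * P))) * (x / (2 * (2 * x + 1))) = p * F ^ 4 / (G\<^sup>2 * (2 * x + 1))"
      if "x > 0" "P > 0" "G > 0" for F G p P x :: real
      using that by (simp add: divide_simps) (simp add: power2_eq_square)
    from this[of "real n" "((real n / exp 1) ^ n) ^ 4" "fact (2*n)" "fact n" "2 ^ (4*n)"] show ?case
      unfolding wallis_prod_eq a4 a2 using elim by simp
  qed
  ultimately have "(\<lambda>n. \<Prod>k=1..n. (4*real k^2) / (4*real k^2 - 1)) \<longlonglongrightarrow> (exp L ^ 4 / (exp L)\<^sup>2) * (1/4)"
    by (rule Lim_transform_eventually)
  then have "(exp L ^ 4 / (exp L)\<^sup>2) * (1/4) = pi / 2"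
    using wallis LIMSEQ_unique by blast
  then have "(exp L)\<^sup>2 = 2 * pi"
    by (simp add: power2_eq_square power4_eq_xxxx)
  then have eL: "exp L = sqrt (2 * pi)"
    by (metis exp_ge_zero real_sqrt_unique)
  have "(\<lambda>n. a n / sqrt (2*pi)) \<longlonglongrightarrow> exp L / sqrt (2*pi)"
    using aL by (intro tendsto_divide) auto
  then show ?thesis
    by (simp add: a_def eL real_sqrt_mult mult_ac)
qed

section \<open>Binomial moments and Bonferroni inequalities\<close>

lemma alternating_binomial_sum:
  "(\<Sum>j\<le>q. (-1) ^ j * real (B choose j)) = (if B = 0 then 1 else (-1) ^ q * real ((B - 1) choose q))"
proof (cases B)
  case 0
  have "(\<Sum>j\<le>q. (-1) ^ j * real (0 choose j)) = (\<Sum>j\<le>q. if j = 0 then 1 else 0)"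
    by (intro sum.cong) auto
  then show ?thesis using 0 by simp
next
  case (Suc b)
  have "(\<Sum>j\<le>q. (-1) ^ j * real (Suc b choose j)) = (-1) ^ q * real (b choose q)"
    by (induction q) (auto simp: algebra_simps)
  then show ?thesis using Suc by simp
qed

text \<open>
  The alternating partial sums are exact for \<open>B \<le> s\<close>; for \<open>B > s\<close> their error has the sign of the last
  term. This is the pointwise form of the Bonferroni inequalities.
\<close>

lemma alternating_binomial_sum_shift:
  "(\<Sum>j\<le>q. (-1) ^ j * real ((s + j) choose s) * real (B choose (s + j))) =
   real (B choose s) * (if B \<le> s then 1 else (-1) ^ q * real ((B - s - 1) choose q))"
proof -
  have "real ((s + j) choose s) * real (B choose (s + j)) = real (B choose s) * real ((B - s) choose j)" for j
  proof (cases "s + j \<le> B")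
    case True
    then show ?thesis
      using choose_mult[of s "s + j" B] by (metis add_diff_cancel_left' le_add1 mult.commute of_nat_mult)
  next
    case False
    then show ?thesis by (cases "s \<le> B") (auto simp: binomial_eq_0)
  qed
  then have "(\<Sum>j\<le>q. (-1) ^ j * real ((s + j) choose s) * real (B choose (s + j))) =
      real (B choose s) * (\<Sum>j\<le>q. (-1) ^ j * real ((B - s) choose j))"
    by (simp add: sum_distrib_left mult.assoc mult.left_commute)
  then show ?thesis
    unfolding alternating_binomial_sum by auto
qed

lemma binomial_card_eq_subsets:
  assumes "finite R"
  shows "real (card {v\<in>R. Q v} choose j) = (\<Sum>U | U \<subseteq> R \<and> card U = j. of_bool (\<forall>v\<in>U. Q v))"
proof -
  have fin: "finite {U. U \<subseteq> R \<and> card U = j}"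
    using assms by simp
  have "card {v\<in>R. Q v} choose j = card {U. U \<subseteq> {v\<in>R. Q v} \<and> card U = j}"
    using assms by (simp add: n_subsets)
  also have "{U. U \<subseteq> {v\<in>R. Q v} \<and> card U = j} = {U. U \<subseteq> R \<and> card U = j} \<inter> {U. \<forall>v\<in>U. Q v}"
    by auto
  finally show ?thesis
    using fin by (simp add: of_bool_def sum.If_cases)
qed

lemma minus_one_power_mult_cancel: "(-1) ^ q * ((-1) ^ q * x) = (x :: real)"
  by (simp add: power_mult_distrib[symmetric] mult.assoc[symmetric])

context prob_space
begin

text \<open>
  The binomial moment \<open>E [1\<^sub>E \<cdot> (B choose j)]\<close> of the number \<open>B\<close> of those \<open>v \<in> R\<close> for which \<open>Q v\<close>
  happens, written as the sum of probabilities by which it is computed.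
\<close>

definition binomial_moment :: "('a \<Rightarrow> bool) \<Rightarrow> ('b \<Rightarrow> 'a \<Rightarrow> bool) \<Rightarrow> 'b set \<Rightarrow> nat \<Rightarrow> real" where
  "binomial_moment E Q R j = (\<Sum>U | U \<subseteq> R \<and> card U = j. \<P>(\<omega> in M. E \<omega> \<and> (\<forall>v\<in>U. Q v \<omega>)))"

lemma integral_of_bool_pred:
  assumes [measurable]: "Measurable.pred M P"
  shows "integrable M (\<lambda>\<omega>. of_bool (P \<omega>) :: real)"
    and "(\<integral>\<omega>. of_bool (P \<omega>) \<partial>M) = \<P>(\<omega> in M. P \<omega>)"
proof -
  show "integrable M (\<lambda>\<omega>. of_bool (P \<omega>) :: real)"
    by (rule integrable_const_bound[where B = 1]) auto
  have "(\<integral>\<omega>. of_bool (P \<omega>) \<partial>M) = (\<integral>\<omega>. indicator {\<omega>\<in>space M. P \<omega>} \<omega> \<partial>M)"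
    by (intro Bochner_Integration.integral_cong) (auto simp: indicator_def)
  also have "\<dots> = \<P>(\<omega> in M. P \<omega>)"
    by (simp add: Int_def conj_ac cong: conj_cong)
  finally show "(\<integral>\<omega>. of_bool (P \<omega>) \<partial>M) = \<P>(\<omega> in M. P \<omega>)" .
qed

context
  fixes E :: "'a \<Rightarrow> bool" and Q :: "'b \<Rightarrow> 'a \<Rightarrow> bool" and R :: "'b set"
  assumes E[measurable]: "Measurable.pred M E" and Q[measurable]: "\<And>v. v \<in> R \<Longrightarrow> Measurable.pred M (Q v)"
    and R: "finite R"
begin

lemma pred_all_subset: "U \<subseteq> R \<Longrightarrow> Measurable.pred M (\<lambda>\<omega>. \<forall>v\<in>U. Q v \<omega>)"
  using R by (intro pred_intros_finite) (auto intro: finite_subset)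

lemma pred_card: "Measurable.pred M (\<lambda>\<omega>. P (card {v\<in>R. Q v \<omega>}))"
proof -
  have "(\<lambda>\<omega>. card {v\<in>R. Q v \<omega>}) = (\<lambda>\<omega>. \<Sum>v\<in>R. if Q v \<omega> then 1 else 0)"
    using R by (auto simp: sum.If_cases Int_def)
  moreover have "(\<lambda>\<omega>. \<Sum>v\<in>R. if Q v \<omega> then 1 else (0::nat)) \<in> measurable M (count_space UNIV)"
    by measurable
  ultimately have "(\<lambda>\<omega>. card {v\<in>R. Q v \<omega>}) \<in> measurable M (count_space UNIV)"
    by simp
  then show ?thesis
    by (rule measurable_compose) simp
qed

lemma binomial_moment_eq_expectation:
  shows "integrable M (\<lambda>\<omega>. of_bool (E \<omega>) * real (card {v\<in>R. Q v \<omega>} choose j))" (is ?int)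
    and "binomial_moment E Q R j = (\<integral>\<omega>. of_bool (E \<omega>) * real (card {v\<in>R. Q v \<omega>} choose j) \<partial>M)"
proof -
  have eq: "(\<lambda>\<omega>. of_bool (E \<omega>) * real (card {v\<in>R. Q v \<omega>} choose j)) =
      (\<lambda>\<omega>. \<Sum>U | U \<subseteq> R \<and> card U = j. of_bool (E \<omega> \<and> (\<forall>v\<in>U. Q v \<omega>)))"
    unfolding binomial_card_eq_subsets[OF R] by (auto simp: sum_distrib_left of_bool_conj)
  have meas: "Measurable.pred M (\<lambda>\<omega>. E \<omega> \<and> (\<forall>v\<in>U. Q v \<omega>))" if "U \<subseteq> R" for U
    using pred_all_subset[OF that] by measurable
  show ?int
    unfolding eq by (intro Bochner_Integration.integrable_sum integral_of_bool_pred meas) auto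
  show "binomial_moment E Q R j = (\<integral>\<omega>. of_bool (E \<omega>) * real (card {v\<in>R. Q v \<omega>} choose j) \<partial>M)"
    unfolding eq binomial_moment_def
    by (subst Bochner_Integration.integral_sum)
       (auto intro!: integral_of_bool_pred meas sum.cong simp: integral_of_bool_pred(2)[OF meas])
qed

lemma bonferroni_eq:
  "(\<Sum>j\<le>q. (-1) ^ j * real ((s + j) choose s) * binomial_moment E Q R (s + j)) =
    \<P>(\<omega> in M. E \<omega> \<and> card {v\<in>R. Q v \<omega>} = s) +
    (-1) ^ q * (\<integral>\<omega>. of_bool (E \<omega>) * (let B = card {v\<in>R. Q v \<omega>} in
       if B \<le> s then 0 else real (B choose s) * real ((B - s - 1) choose q)) \<partial>M)"
proof -
  note [measurable] = pred_card
  define h where "h B = (if B \<le> s then 0 else real (B choose s) * real ((B - s - 1) choose q))" for B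
  have pt: "of_bool (E \<omega>) * h B = (-1) ^ q * ((\<Sum>j\<le>q. (-1) ^ j * real ((s + j) choose s) * (of_bool (E \<omega>) * real (B choose (s + j))))
      - of_bool (E \<omega> \<and> B = s))" for \<omega> B
  proof -
    have "(\<Sum>j\<le>q. (-1) ^ j * real ((s + j) choose s) * (of_bool (E \<omega>) * real (B choose (s + j)))) =
      of_bool (E \<omega>) * (\<Sum>j\<le>q. (-1) ^ j * real ((s + j) choose s) * real (B choose (s + j)))"
      by (simp add: sum_distrib_left mult_ac)
    then show ?thesis
      unfolding alternating_binomial_sum_shift
      by (auto simp: h_def binomial_eq_0 power_mult_distrib[symmetric])
  qed
  have i1: "integrable M (\<lambda>\<omega>. \<Sum>j\<le>q. (-1) ^ j * real ((s + j) choose s) * (of_bool (E \<omega>) * real (card {v\<in>R. Q v \<omega>} choose (s + j))))"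
    by (intro Bochner_Integration.integrable_sum integrable_mult_right binomial_moment_eq_expectation)
  have i3: "(\<integral>\<omega>. (\<Sum>j\<le>q. (-1) ^ j * real ((s + j) choose s) * (of_bool (E \<omega>) * real (card {v\<in>R. Q v \<omega>} choose (s + j)))) \<partial>M) =
      (\<Sum>j\<le>q. (-1) ^ j * real ((s + j) choose s) * binomial_moment E Q R (s + j))"
    by (subst Bochner_Integration.integral_sum, intro integrable_mult_right binomial_moment_eq_expectation)
       (simp only: integral_mult_right_zero binomial_moment_eq_expectation(2))
  have i2: "integrable M (\<lambda>\<omega>. of_bool (E \<omega> \<and> card {v\<in>R. Q v \<omega>} = s) :: real)"
    by (intro integral_of_bool_pred) measurable
  have "(\<integral>\<omega>. of_bool (E \<omega>) * h (card {v\<in>R. Q v \<omega>}) \<partial>M) =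
     (-1) ^ q * ((\<Sum>j\<le>q. (-1) ^ j * real ((s + j) choose s) * binomial_moment E Q R (s + j))
       - \<P>(\<omega> in M. E \<omega> \<and> card {v\<in>R. Q v \<omega>} = s))"
    unfolding pt integral_mult_right_zero Bochner_Integration.integral_diff[OF i1 i2] i3
    by (subst integral_of_bool_pred(2)) simp_all
  then show ?thesis
    unfolding h_def Let_def by (simp add: minus_one_power_mult_cancel)
qed

lemma bonferroni_nonneg:
  "(\<integral>\<omega>. of_bool (E \<omega>) * (let B = card {v\<in>R. Q v \<omega>} in
       if B \<le> s then 0 else real (B choose s) * real ((B - s - 1) choose q)) \<partial>M) \<ge> 0"
  by (intro integral_nonneg_AE) (auto simp: Let_def)

lemma bonferroni_lower:
  assumes "odd q"
  shows "(\<Sum>j\<le>q. (-1) ^ j * real ((s + j) choose s) * binomial_moment E Q R (s + j)) \<le>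
    \<P>(\<omega> in M. E \<omega> \<and> card {v\<in>R. Q v \<omega>} = s)"
  using bonferroni_nonneg[of s q] assms unfolding bonferroni_eq by simp

lemma bonferroni_upper:
  assumes "even q"
  shows "\<P>(\<omega> in M. E \<omega> \<and> card {v\<in>R. Q v \<omega>} = s) \<le>
    (\<Sum>j\<le>q. (-1) ^ j * real ((s + j) choose s) * binomial_moment E Q R (s + j))"
  using bonferroni_nonneg[of s q] assms unfolding bonferroni_eq by simp

text \<open>
  For \<open>B\<close> a count, \<open>1 - (1 - B/r)\<^sup>2\<close> is at most 1 and vanishes at \<open>B = 0\<close>, so its expectation bounds the
  probability of \<open>B > 0\<close> from below. Expanding the square in binomial moments gives the left-hand side.
\<close>

lemma second_moment_lower:
  assumes "r > 0"
  shows "2 * (binomial_moment E Q R 1 / r) - (binomial_moment E Q R 1 / r) / r - 2 * (binomial_moment E Q R 2 / r\<^sup>2)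
     \<le> \<P>(\<omega> in M. E \<omega> \<and> card {v\<in>R. Q v \<omega>} > 0)"
proof -
  note [measurable] = pred_card
  define b where "b j \<omega> = of_bool (E \<omega>) * real (card {v\<in>R. Q v \<omega>} choose j)" for j \<omega>
  have int: "integrable M (b j)" for j
    unfolding b_def by (rule binomial_moment_eq_expectation)
  have pt: "2 * (b 1 \<omega> / r) - (b 1 \<omega> / r) / r - 2 * (b 2 \<omega> / r\<^sup>2)
      \<le> of_bool (E \<omega> \<and> card {v\<in>R. Q v \<omega>} > 0)" for \<omega>
  proof (cases "E \<omega> \<and> card {v\<in>R. Q v \<omega>} > 0")
    case True
    define B where "B = card {v\<in>R. Q v \<omega>}"
    have "2 * real (B choose 2) = real B * (real B - 1)"
    proof -
      have "2 * (B choose 2) = B * (B - 1)" by (subst choose_two, subst dvd_mult_div_cancel) auto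
      then have "2 * real (B choose 2) = real (B * (B - 1))" by (metis of_nat_mult of_nat_numeral)
      then show ?thesis using True by (simp add: B_def of_nat_diff Suc_leI)
    qed
    then have "2 * (real (B choose 2) / r\<^sup>2) = real B * (real B - 1) / r\<^sup>2"
      by (metis times_divide_eq_right)
    then have "2 * (real (B choose 1) / r) - (real (B choose 1) / r) / r - 2 * (real (B choose 2) / r\<^sup>2) =
        2 * (real B / r) - real B / r / r - real B * (real B - 1) / r\<^sup>2"
      by (simp only: choose_one)
    also have "\<dots> = 1 - (1 - real B / r)\<^sup>2"
      using assms by (simp add: field_simps power2_eq_square)
    also have "\<dots> \<le> 1" by simp
    finally show ?thesis using True unfolding b_def B_def by simp
  next
    case False
    then show ?thesis by (auto simp: b_def binomial_eq_0)
  qed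
  have "(\<integral>\<omega>. 2 * (b 1 \<omega> / r) - (b 1 \<omega> / r) / r - 2 * (b 2 \<omega> / r\<^sup>2) \<partial>M) \<le> (\<integral>\<omega>. of_bool (E \<omega> \<and> card {v\<in>R. Q v \<omega>} > 0) \<partial>M)"
    by (intro integral_mono pt integral_of_bool_pred Bochner_Integration.integrable_diff integrable_mult_right
        integrable_divide_zero int) simp_all
  then show ?thesis
    unfolding binomial_moment_eq_expectation(2) b_def[symmetric]
    by (subst (asm) integral_of_bool_pred(2)) (use int in simp_all)
qed

end

end

section \<open>The counts after a fixed number of draws\<close>

text \<open>
  The probability that the types in \<open>C\<close> are drawn \<open>b c\<close> times each in \<open>t\<close> draws from \<open>n\<close> types. Writing
  the factorial quotient through \<open>t choose (sum b C)\<close> makes it \<open>0\<close> when more than \<open>t\<close> draws are prescribed,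
  despite the truncated subtraction in the last exponent.
\<close>

definition multinomial :: "nat \<Rightarrow> nat \<Rightarrow> (nat \<Rightarrow> nat) \<Rightarrow> nat set \<Rightarrow> real" where
  "multinomial n t b C = real (t choose sum b C) * fact (sum b C) / (\<Prod>c\<in>C. fact (b c)) *
     (1 / n) ^ sum b C * (1 - card C / n) ^ (t - sum b C)"

locale coupon = prob_space M for M :: "'a measure" +
  fixes n :: nat and X :: "nat \<Rightarrow> 'a \<Rightarrow> nat"
  assumes indep: "indep_vars (\<lambda>_. count_space UNIV) X UNIV"
    and draw_law: "distr M (count_space UNIV) (X i) = measure_pmf (pmf_of_set {..<n})"
    and n_pos: "n > 0"
begin

abbreviation N :: "nat \<Rightarrow> nat \<Rightarrow> 'a \<Rightarrow> nat" where
  "N \<equiv> copies X"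

lemma measurable_draw [measurable]: "X i \<in> measurable M (count_space UNIV)"
  using indep unfolding indep_vars_def by simp

lemma copies_0 [simp]: "N 0 c \<omega> = 0"
  by (simp add: copies_def)

lemma copies_Suc: "N (Suc t) c \<omega> = N t c \<omega> + (if X t \<omega> = c then 1 else 0)"
proof -
  have "{i. i < Suc t \<and> X i \<omega> = c} = (if X t \<omega> = c then insert t {i. i < t \<and> X i \<omega> = c} else {i. i < t \<and> X i \<omega> = c})"
    by (auto simp: less_Suc_eq)
  then show ?thesis by (simp add: copies_def)
qed

lemma copies_mono: "s \<le> t \<Longrightarrow> N s c \<omega> \<le> N t c \<omega>"
  unfolding copies_def by (intro card_mono) auto

lemma measurable_copies [measurable]: "N t c \<in> measurable M (count_space UNIV)"
proof (induction t)
  case 0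
  then show ?case by (simp add: copies_def[abs_def])
next
  case (Suc t)
  note [measurable] = Suc
  have "(\<lambda>\<omega>. N t c \<omega> + (if X t \<omega> = c then 1 else 0)) \<in> measurable M (count_space UNIV)"
    by measurable
  then show ?case by (simp add: copies_Suc[abs_def])
qed

lemma prob_draw: "\<P>(\<omega> in M. X t \<omega> = v) = (if v < n then 1 / n else 0)"
proof -
  have "\<P>(\<omega> in M. X t \<omega> = v) = measure (distr M (count_space UNIV) (X t)) {v}"
    by (subst measure_distr) (auto intro!: arg_cong[where f = prob])
  also have "\<dots> = (if v < n then 1 / n else 0)"
    using n_pos unfolding draw_law by (subst measure_pmf_single) (auto simp: pmf_of_set lessThan_empty_iff indicator_def)
  finally show ?thesis .
qed

lemma AE_draw: "AE \<omega> in M. X t \<omega> < n"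
proof -
  have "AE x in measure_pmf (pmf_of_set {..<n}). x < n"
    using n_pos by (auto simp: AE_measure_pmf_iff set_pmf_of_set lessThan_empty_iff)
  then show ?thesis
    unfolding draw_law[of t, symmetric] by (subst (asm) AE_distr_iff) auto
qed

text \<open>
  The counts after \<open>t\<close> draws are a function of the draws \<open>0, \<dots>, t - 1\<close>, which are independent of
  draw \<open>t\<close>.
\<close>

lemma draw_indep_past:
  "\<P>(\<omega> in M. Q (\<lambda>c. N t c \<omega>) \<and> X t \<omega> = v) = \<P>(\<omega> in M. Q (\<lambda>c. N t c \<omega>)) * (if v < n then 1 / n else 0)"
proof -
  let ?A = "\<lambda>\<omega>. restrict (\<lambda>i. X i \<omega>) {..<t}" and ?B = "\<lambda>\<omega>. restrict (\<lambda>i. X i \<omega>) {t}"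
  let ?SA = "Pi\<^sub>M {..<t} (\<lambda>_. count_space UNIV) :: (nat \<Rightarrow> nat) measure"
    and ?SB = "Pi\<^sub>M {t} (\<lambda>_. count_space UNIV) :: (nat \<Rightarrow> nat) measure"
  have iv: "indep_var ?SA ?A ?SB ?B"
    by (rule indep_var_restrict[OF indep]) auto
  have cs: "?SA = count_space (Pi\<^sub>E {..<t} (\<lambda>_. UNIV))" "?SB = count_space (Pi\<^sub>E {t} (\<lambda>_. UNIV))"
    by (intro count_space_PiM_finite; auto)+
  define A where "A = ?A"
  define B where "B = ?B"
  define F where "F = {f \<in> Pi\<^sub>E {..<t} (\<lambda>_. UNIV). Q (\<lambda>c. card {i. i < t \<and> f i = c})}"
  define G where "G = {f \<in> Pi\<^sub>E {t} (\<lambda>_. UNIV). f t = v}"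
  have "N t c \<omega> = card {i. i < t \<and> A \<omega> i = c}" for c \<omega>
    unfolding copies_def A_def by (intro arg_cong[where f = card]) auto
  then have AF: "A \<omega> \<in> F \<longleftrightarrow> Q (\<lambda>c. N t c \<omega>)" for \<omega>
    unfolding F_def by (simp add: A_def)
  have BG: "B \<omega> \<in> G \<longleftrightarrow> X t \<omega> = v" for \<omega>
    unfolding G_def by (simp add: B_def)
  have "prob ((\<lambda>\<omega>. (A \<omega>, B \<omega>)) -` (F \<times> G) \<inter> space M) = prob (A -` F \<inter> space M) * prob (B -` G \<inter> space M)"
    unfolding A_def B_def by (rule indep_varD[OF iv]) (auto simp: cs F_def G_def)
  moreover have "(\<lambda>\<omega>. (A \<omega>, B \<omega>)) -` (F \<times> G) \<inter> space M = {\<omega>\<in>space M. Q (\<lambda>c. N t c \<omega>) \<and> X t \<omega> = v}"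
    by (auto simp: AF BG)
  moreover have "A -` F \<inter> space M = {\<omega>\<in>space M. Q (\<lambda>c. N t c \<omega>)}"
    by (auto simp: AF)
  moreover have "B -` G \<inter> space M = {\<omega>\<in>space M. X t \<omega> = v}"
    by (auto simp: BG)
  ultimately show ?thesis
    using prob_draw[of t v] by simp
qed

lemma measurable_past [measurable]: "Measurable.pred M (\<lambda>\<omega>. Q (\<lambda>c. N t c \<omega>))"
proof -
  let ?A = "\<lambda>\<omega>. restrict (\<lambda>i. X i \<omega>) {..<t}"
  have "?A \<in> measurable M (Pi\<^sub>M {..<t} (\<lambda>_. count_space UNIV))"
    by (intro measurable_restrict) simp
  then have A: "?A \<in> measurable M (count_space (Pi\<^sub>E {..<t} (\<lambda>_. UNIV)))"
    by (subst (asm) count_space_PiM_finite) auto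
  have c: "(\<lambda>c. N t c \<omega>) = (\<lambda>c. card {i. i < t \<and> ?A \<omega> i = c})" for \<omega>
    unfolding copies_def by (intro ext arg_cong[where f = card]) auto
  show ?thesis
    unfolding c by (rule measurable_compose[OF A]) simp
qed

text \<open>
  A draw of a type outside \<open>C\<close> leaves the relevant counts as they are; a draw of \<open>v \<in> C\<close> must have been
  preceded by one copy of \<open>v\<close> less.
\<close>

lemma prob_copies_Suc:
  assumes C: "finite C" "C \<subseteq> {..<n}"
  shows "\<P>(\<omega> in M. \<forall>c\<in>C. N (Suc t) c \<omega> = b c) =
    (1 - card C / n) * \<P>(\<omega> in M. \<forall>c\<in>C. N t c \<omega> = b c) +
    (\<Sum>v\<in>C. if b v = 0 then 0 else \<P>(\<omega> in M. \<forall>c\<in>C. N t c \<omega> = (b(v := b v - 1)) c) / n)"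
proof -
  let ?E = "\<lambda>v \<omega>. (\<forall>c\<in>C. N t c \<omega> + (if v = c then 1 else 0) = b c)"
  have "\<P>(\<omega> in M. \<forall>c\<in>C. N (Suc t) c \<omega> = b c) = (\<Sum>v\<in>{..<n}. \<P>(\<omega> in M. ?E v \<omega> \<and> X t \<omega> = v))"
    unfolding copies_Suc
    by (rule prob_sum) (use AE_draw[of t] in \<open>auto elim: AE_mp\<close>)
  also have "\<dots> = (\<Sum>v<n. \<P>(\<omega> in M. ?E v \<omega>) / n)"
    by (intro sum.cong refl) (subst draw_indep_past[where Q = "\<lambda>f. \<forall>c\<in>C. f c + (if v = c then 1 else 0) = b c" for v]; simp)
  also have "\<dots> = (\<Sum>v\<in>{..<n} - C. \<P>(\<omega> in M. ?E v \<omega>) / n) + (\<Sum>v\<in>C. \<P>(\<omega> in M. ?E v \<omega>) / n)"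
    using C by (intro sum.subset_diff) auto
  also have "(\<Sum>v\<in>{..<n} - C. \<P>(\<omega> in M. ?E v \<omega>) / n) = (\<Sum>v\<in>{..<n} - C. \<P>(\<omega> in M. \<forall>c\<in>C. N t c \<omega> = b c) / n)"
    by (intro sum.cong arg_cong2[where f = "(/)"] arg_cong[where f = prob] Collect_cong) auto
  also have "\<dots> = (1 - card C / n) * \<P>(\<omega> in M. \<forall>c\<in>C. N t c \<omega> = b c)"
    using C n_pos card_mono[of "{..<n}" C] by (simp add: card_Diff_subset of_nat_diff field_simps)
  also have "(\<Sum>v\<in>C. \<P>(\<omega> in M. ?E v \<omega>) / n) =
     (\<Sum>v\<in>C. if b v = 0 then 0 else \<P>(\<omega> in M. \<forall>c\<in>C. N t c \<omega> = (b(v := b v - 1)) c) / n)"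
  proof (intro sum.cong refl)
    fix v assume v: "v \<in> C"
    show "\<P>(\<omega> in M. ?E v \<omega>) / n = (if b v = 0 then 0 else \<P>(\<omega> in M. \<forall>c\<in>C. N t c \<omega> = (b(v := b v - 1)) c) / n)"
    proof (cases "b v = 0")
      case True
      then have "{\<omega>\<in>space M. ?E v \<omega>} = {}" using v by auto
      then show ?thesis using True by (simp del: Collect_empty_eq)
    next
      case False
      then have "?E v \<omega> \<longleftrightarrow> (\<forall>c\<in>C. N t c \<omega> = (b(v := b v - 1)) c)" for \<omega>
        by (intro ball_cong) auto
      then show ?thesis using False by simp
    qed
  qed
  finally show ?thesis .
qed

text \<open>
  Induction over \<open>t\<close>: conditioning on the last draw, the claim becomes the multinomial Pascal identity
  \<open>(t + 1 choose B) = (t choose B) + (t choose (B - 1))\<close> for the total count \<open>B\<close>.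
\<close>

lemma prob_copies_eq:
  assumes C: "finite C" "C \<subseteq> {..<n}"
  shows "\<P>(\<omega> in M. \<forall>c\<in>C. N t c \<omega> = b c) = multinomial n t b C"
proof (induction t arbitrary: b)
  case 0
  show ?case
  proof (cases "\<forall>c\<in>C. b c = 0")
    case True
    then show ?thesis using C by (simp add: multinomial_def prob_space)
  next
    case False
    then have "{\<omega>\<in>space M. \<forall>c\<in>C. N 0 c \<omega> = b c} = {}" by auto
    moreover have "sum b C \<noteq> 0" using False C by auto
    ultimately show ?thesis by (simp add: multinomial_def binomial_eq_0 del: Collect_empty_eq sum_eq_0_iff)
  qed
next
  case (Suc t)
  define B where "B = sum b C"
  define D where "D = (\<Prod>c\<in>C. fact (b c) :: real)"
  define w where "w = 1 - card C / real n"
  have D: "D > 0" unfolding D_def by (intro prod_pos) auto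
  have upd: "multinomial n t (b(v := b v - 1)) C = real (t choose (B - 1)) * fact (B - 1) * real (b v) / D *
      (1 / n) ^ (B - 1) * w ^ (t - (B - 1))" if "v \<in> C" "b v \<noteq> 0" for v
  proof -
    have s: "sum (b(v := b v - 1)) C = B - 1"
      using that C unfolding B_def by (subst sum.remove[OF _ that(1)], simp, subst sum.remove[OF _ that(1), of b], simp)
        (auto intro!: sum.cong)
    have "D = fact (b v) * (\<Prod>c\<in>C - {v}. fact (b c))"
      unfolding D_def using C that by (intro prod.remove) auto
    also have "\<dots> = real (b v) * (fact (b v - 1) * (\<Prod>c\<in>C - {v}. fact (b c)))"
      using that by (simp add: fact_reduce)
    also have "fact (b v - 1) * (\<Prod>c\<in>C - {v}. fact (b c)) = (\<Prod>c\<in>C. fact ((b(v := b v - 1)) c) :: real)"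
      using C that by (subst prod.remove[OF _ that(1)]) (auto intro!: prod.cong)
    finally have D': "D = real (b v) * (\<Prod>c\<in>C. fact ((b(v := b v - 1)) c))" .
    show ?thesis
      unfolding multinomial_def s D' w_def using that by simp
  qed
  have "\<P>(\<omega> in M. \<forall>c\<in>C. N (Suc t) c \<omega> = b c) =
      w * multinomial n t b C +
      (\<Sum>v\<in>C. real (b v) * (real (t choose (B - 1)) * fact (B - 1) / D * (1 / n) ^ (B - 1) * w ^ (t - (B - 1)) / n))"
    unfolding prob_copies_Suc[OF C] Suc.IH w_def[symmetric]
    by (intro arg_cong2[where f = "(+)"] refl sum.cong) (auto simp: fun_upd_def upd[unfolded fun_upd_def One_nat_def])
  also have "\<dots> = w * multinomial n t b C +
      real B * (real (t choose (B - 1)) * fact (B - 1) / D * (1 / n) ^ (B - 1) * w ^ (t - (B - 1)) / n)"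
    unfolding sum_distrib_right[symmetric] by (simp add: B_def)
  also have "\<dots> = multinomial n (Suc t) b C"
  proof (cases B)
    case 0
    then show ?thesis
      by (simp add: multinomial_def B_def[symmetric] D_def[symmetric] w_def[symmetric])
  next
    case (Suc B')
    have 1: "w * (real (t choose B) * w ^ (t - B)) = real (t choose B) * w ^ (Suc t - B)"
      by (cases "B \<le> t") (auto simp: Suc_diff_le binomial_eq_0)
    have "multinomial n (Suc t) b C = (real (t choose B) + real (t choose B')) * fact B / D * (1 / n) ^ B * w ^ (Suc t - B)"
      unfolding multinomial_def B_def[symmetric] D_def[symmetric] w_def[symmetric] using Suc by simp
    also have "\<dots> = (real (t choose B) * w ^ (Suc t - B)) * fact B / D * (1 / n) ^ B +
        real (t choose B') * fact B / D * (1 / n) ^ B * w ^ (t - B')"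
      using Suc by (simp add: algebra_simps add_divide_distrib)
    finally show ?thesis
      unfolding 1[symmetric] unfolding multinomial_def B_def[symmetric] D_def[symmetric] w_def[symmetric] using Suc
      by (simp add: mult_ac)
  qed
  finally show ?case .
qed

end

section \<open>The draw that completes the collection\<close>

context coupon
begin

text \<open>
  Draw number \<open>t\<close>, counted from \<open>0\<close>, is the one after which the collection stops.
\<close>

definition completes :: "nat \<Rightarrow> nat \<Rightarrow> 'a \<Rightarrow> bool" where
  "completes m t \<omega> \<longleftrightarrow> (\<exists>c<n. X t \<omega> = c \<and> N t c \<omega> = m - 1 \<and> (\<forall>v<n. v \<noteq> c \<longrightarrow> m \<le> N t v \<omega>))"

lemma measurable_completes [measurable]: "Measurable.pred M (completes m t)"
  unfolding completes_def by measurable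

lemma stop_time_completes:
  assumes "m \<ge> 1" "completes m t \<omega>"
  shows "stop_time m n X \<omega> = Suc t"
proof -
  obtain c where c: "c < n" "X t \<omega> = c" "N t c \<omega> = m - 1" "\<And>v. v < n \<Longrightarrow> v \<noteq> c \<Longrightarrow> m \<le> N t v \<omega>"
    using assms(2) unfolding completes_def by auto
  show ?thesis
    unfolding stop_time_def
  proof (rule Least_equality)
    show "\<forall>v<n. m \<le> N (Suc t) v \<omega>"
      using c assms(1) by (auto simp: copies_Suc)
  next
    fix u assume u: "\<forall>v<n. m \<le> N u v \<omega>"
    show "Suc t \<le> u"
    proof (rule ccontr)
      assume "\<not> Suc t \<le> u"
      then have "N u c \<omega> \<le> N t c \<omega>" by (intro copies_mono) auto
      then show False using u c assms(1) by fastforce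
    qed
  qed
qed

text \<open>
  The last coupon raises one count from \<open>m - 1\<close> to \<open>m\<close>, neither of which is \<open>k\<close>, so the \<open>k\<close>-tons can
  be counted before it is drawn.
\<close>

lemma num_tons_completes:
  assumes "m \<ge> 1" "m < k" "completes m t \<omega>"
  shows "num_tons m n X k \<omega> = card {v\<in>{..<n}. N t v \<omega> = k}"
proof -
  obtain c where c: "c < n" "X t \<omega> = c" "N t c \<omega> = m - 1"
    using assms(3) unfolding completes_def by auto
  have "{v. v < n \<and> N (Suc t) v \<omega> = k} = {v\<in>{..<n}. N t v \<omega> = k}"
    using c assms(1,2) by (auto simp: copies_Suc split: if_splits)
  then show ?thesis
    unfolding num_tons_def stop_time_completes[OF assms(1,3)] by simp
qed

lemma measurable_stop_time [measurable]: "stop_time m n X \<in> measurable M (count_space UNIV)"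
  unfolding stop_time_def[abs_def] by measurable

lemma measurable_num_tons [measurable]: "num_tons m n X k \<in> measurable M (count_space UNIV)"
proof -
  have eq: "num_tons m n X k = (\<lambda>\<omega>. \<Sum>c<n. if N (stop_time m n X \<omega>) c \<omega> = k then 1 else 0)"
    by (auto simp: num_tons_def fun_eq_iff sum.If_cases Int_def)
  have [measurable]: "(\<lambda>\<omega>. N (stop_time m n X \<omega>) c \<omega>) \<in> measurable M (count_space UNIV)" for c
    by (rule measurable_compose_countable[where f = "\<lambda>t \<omega>. N t c \<omega>"]) measurable
  show ?thesis
    unfolding eq by measurable
qed

definition ton_moment :: "nat \<Rightarrow> nat \<Rightarrow> nat \<Rightarrow> nat \<Rightarrow> real" where
  "ton_moment m k t s = binomial_moment (completes m t) (\<lambda>v \<omega>. N t v \<omega> = k) {..<n} s"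

text \<open>
  The type \<open>c\<close> of the last coupon is independent of the counts before it, which gives the factor \<open>1/n\<close>.
  The requirement that no other type is short of \<open>m\<close> copies concerns only types outside \<open>K\<close>, because
  \<open>k \<ge> m\<close>; it is put in the form to which the Bonferroni inequalities apply.
\<close>

lemma ton_moment_eq:
  assumes "m \<le> k" "m \<ge> 1"
  shows "ton_moment m k t s = (\<Sum>K | K \<subseteq> {..<n} \<and> card K = s. \<Sum>c\<in>{..<n} - K.
     \<P>(\<omega> in M. (N t c \<omega> = m - 1 \<and> (\<forall>v\<in>K. N t v \<omega> = k)) \<and> card {v\<in>{..<n} - insert c K. N t v \<omega> < m} = 0) / n)"
  unfolding ton_moment_def binomial_moment_def
proof (rule sum.cong[OF refl], clarsimp simp only: mem_Collect_eq)
  fix K assume K: "K \<subseteq> {..<n}"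
  let ?E = "\<lambda>c (f :: nat \<Rightarrow> nat). f c = m - 1 \<and> (\<forall>v\<in>K. f v = k) \<and> (\<forall>v<n. v \<noteq> c \<longrightarrow> m \<le> f v)"
  have "\<P>(\<omega> in M. completes m t \<omega> \<and> (\<forall>v\<in>K. N t v \<omega> = k)) = (\<Sum>c<n. \<P>(\<omega> in M. ?E c (\<lambda>v. N t v \<omega>) \<and> X t \<omega> = c))"
    by (rule prob_sum) (auto simp: completes_def)
  also have "\<dots> = (\<Sum>c<n. \<P>(\<omega> in M. ?E c (\<lambda>v. N t v \<omega>)) / n)"
    by (intro sum.cong refl) (subst draw_indep_past; simp)
  also have "\<dots> = (\<Sum>c\<in>{..<n} - K. \<P>(\<omega> in M. ?E c (\<lambda>v. N t v \<omega>)) / n)"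
  proof (intro sum.mono_neutral_right ballI)
    fix c assume "c \<in> {..<n} - ({..<n} - K)"
    then have "{\<omega>\<in>space M. ?E c (\<lambda>v. N t v \<omega>)} = {}" using assms by auto
    then show "\<P>(\<omega> in M. ?E c (\<lambda>v. N t v \<omega>)) / n = 0" by (simp del: Collect_empty_eq)
  qed auto
  also have "\<dots> = (\<Sum>c\<in>{..<n} - K.
     \<P>(\<omega> in M. (N t c \<omega> = m - 1 \<and> (\<forall>v\<in>K. N t v \<omega> = k)) \<and> card {v\<in>{..<n} - insert c K. N t v \<omega> < m} = 0) / n)"
  proof (intro sum.cong refl arg_cong2[where f = "(/)"] arg_cong[where f = prob] Collect_cong)
    fix c \<omega> assume c: "c \<in> {..<n} - K"
    have "card {v\<in>{..<n} - insert c K. N t v \<omega> < m} = 0 \<longleftrightarrow> (\<forall>v\<in>{..<n} - insert c K. m \<le> N t v \<omega>)"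
      unfolding not_less[symmetric] by (subst card_0_eq) auto
    then show "\<omega> \<in> space M \<and> ?E c (\<lambda>v. N t v \<omega>) \<longleftrightarrow> \<omega> \<in> space M \<and> (N t c \<omega> = m - 1 \<and> (\<forall>v\<in>K. N t v \<omega> = k)) \<and> card {v\<in>{..<n} - insert c K. N t v \<omega> < m} = 0"
      using c assms(1) by auto
  qed
  finally show "\<P>(\<omega> in M. completes m t \<omega> \<and> (\<forall>v\<in>K. N t v \<omega> = k)) = (\<Sum>c\<in>{..<n} - K.
     \<P>(\<omega> in M. (N t c \<omega> = m - 1 \<and> (\<forall>v\<in>K. N t v \<omega> = k)) \<and> card {v\<in>{..<n} - insert c K. N t v \<omega> < m} = 0) / n)" .
qed

text \<open>
  The term of order \<open>j\<close> in the inclusion and exclusion over types short of \<open>m\<close> copies: \<open>K\<close> collects \<open>s\<close>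
  many \<open>k\<close>-tons, and \<open>c\<close> is the type that the next coupon is to complete.
\<close>

definition mixed_moment :: "nat \<Rightarrow> nat \<Rightarrow> nat \<Rightarrow> nat \<Rightarrow> nat \<Rightarrow> real" where
  "mixed_moment m k t s j = (\<Sum>K | K \<subseteq> {..<n} \<and> card K = s. \<Sum>c\<in>{..<n} - K.
     binomial_moment (\<lambda>\<omega>. N t c \<omega> = m - 1 \<and> (\<forall>v\<in>K. N t v \<omega> = k)) (\<lambda>v \<omega>. N t v \<omega> < m) ({..<n} - insert c K) j)"

lemma
  assumes "m \<le> k" "m \<ge> 1"
  shows ton_moment_lower: "odd q \<Longrightarrow> (\<Sum>j\<le>q. (-1) ^ j * mixed_moment m k t s j) \<le> n * ton_moment m k t s"
    and ton_moment_upper: "even q \<Longrightarrow> n * ton_moment m k t s \<le> (\<Sum>j\<le>q. (-1) ^ j * mixed_moment m k t s j)"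
proof -
  let ?\<K> = "{K. K \<subseteq> {..<n} \<and> card K = s}"
  let ?E = "\<lambda>K c \<omega>. N t c \<omega> = m - 1 \<and> (\<forall>v\<in>K. N t v \<omega> = k)"
  let ?R = "\<lambda>K c. {..<n} - insert c K"
  have [measurable]: "Measurable.pred M (?E K c)" for K c
    by (rule measurable_past[where Q = "\<lambda>f. f c = m - 1 \<and> (\<forall>v\<in>K. f v = k)"])
  have eq: "n * ton_moment m k t s = (\<Sum>K\<in>?\<K>. \<Sum>c\<in>{..<n} - K. \<P>(\<omega> in M. ?E K c \<omega> \<and> card {v\<in>?R K c. N t v \<omega> < m} = 0))"
    unfolding ton_moment_eq[OF assms] using n_pos by (simp add: sum_divide_distrib[symmetric])
  have eq2: "(\<Sum>j\<le>q. (-1) ^ j * mixed_moment m k t s j) = (\<Sum>K\<in>?\<K>. \<Sum>c\<in>{..<n} - K.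
     (\<Sum>j\<le>q. (-1) ^ j * real ((0 + j) choose 0) * binomial_moment (?E K c) (\<lambda>v \<omega>. N t v \<omega> < m) (?R K c) (0 + j)))"
    unfolding mixed_moment_def
    by (simp add: sum_distrib_left sum.swap[of _ "{..q}"])
  show "(\<Sum>j\<le>q. (-1) ^ j * mixed_moment m k t s j) \<le> n * ton_moment m k t s" if "odd q"
    unfolding eq eq2 by (intro sum_mono bonferroni_lower that) auto
  show "n * ton_moment m k t s \<le> (\<Sum>j\<le>q. (-1) ^ j * mixed_moment m k t s j)" if "even q"
    unfolding eq eq2 by (intro sum_mono bonferroni_upper that) auto
qed

lemma num_tons_lower:
  assumes "m \<ge> 1" "m < k" "odd q"
  shows "(\<Sum>j\<le>q. (-1) ^ j * real ((s + j) choose s) * ton_moment m k t (s + j)) \<le>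
    \<P>(\<omega> in M. completes m t \<omega> \<and> num_tons m n X k \<omega> = s)"
proof -
  have "(\<Sum>j\<le>q. (-1) ^ j * real ((s + j) choose s) * ton_moment m k t (s + j)) \<le>
    \<P>(\<omega> in M. completes m t \<omega> \<and> card {v\<in>{..<n}. N t v \<omega> = k} = s)"
    unfolding ton_moment_def by (intro bonferroni_lower assms) auto
  also have "\<dots> = \<P>(\<omega> in M. completes m t \<omega> \<and> num_tons m n X k \<omega> = s)"
    by (intro arg_cong[where f = prob]) (auto simp: num_tons_completes[OF assms(1,2)])
  finally show ?thesis .
qed

lemma num_tons_upper:
  assumes "m \<ge> 1" "m < k" "even q"
  shows "\<P>(\<omega> in M. completes m t \<omega> \<and> num_tons m n X k \<omega> = s) \<le>
    (\<Sum>j\<le>q. (-1) ^ j * real ((s + j) choose s) * ton_moment m k t (s + j))"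
proof -
  have "\<P>(\<omega> in M. completes m t \<omega> \<and> num_tons m n X k \<omega> = s) =
    \<P>(\<omega> in M. completes m t \<omega> \<and> card {v\<in>{..<n}. N t v \<omega> = k} = s)"
    by (intro arg_cong[where f = prob]) (auto simp: num_tons_completes[OF assms(1,2)])
  also have "\<dots> \<le> (\<Sum>j\<le>q. (-1) ^ j * real ((s + j) choose s) * ton_moment m k t (s + j))"
    unfolding ton_moment_def by (intro bonferroni_upper assms) auto
  finally show ?thesis .
qed

lemma num_tons_positive_lower:
  assumes "m \<ge> 1" "m < k" "r > 0"
  shows "2 * (ton_moment m k t 1 / r) - (ton_moment m k t 1 / r) / r - 2 * (ton_moment m k t 2 / r\<^sup>2)
     \<le> \<P>(\<omega> in M. completes m t \<omega> \<and> num_tons m n X k \<omega> > 0)"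
proof -
  have "2 * (ton_moment m k t 1 / r) - (ton_moment m k t 1 / r) / r - 2 * (ton_moment m k t 2 / r\<^sup>2)
     \<le> \<P>(\<omega> in M. completes m t \<omega> \<and> card {v\<in>{..<n}. N t v \<omega> = k} > 0)"
    unfolding ton_moment_def by (intro second_moment_lower assms) auto
  also have "\<dots> = \<P>(\<omega> in M. completes m t \<omega> \<and> num_tons m n X k \<omega> > 0)"
    by (intro arg_cong[where f = prob]) (auto simp: num_tons_completes[OF assms(1,2)])
  finally show ?thesis .
qed

end

section \<open>Poisson approximation of the counts\<close>

definition poisson_weight :: "real \<Rightarrow> nat \<Rightarrow> real" where
  "poisson_weight l i = l ^ i / fact i * exp (- l)"

lemma poisson_weight_nonneg: "l \<ge> 0 \<Longrightarrow> poisson_weight l i \<ge> 0"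
  by (simp add: poisson_weight_def)

lemma falling_factorial_bounds:
  assumes "B \<le> t"
  shows "(real t - real B) ^ B \<le> real (t choose B) * fact B" "real (t choose B) * fact B \<le> real t ^ B"
proof -
  have eq: "real (t choose B) * fact B = (\<Prod>i=0..<B. real t - real i)"
    by (simp add: binomial_gbinomial gbinomial_prod_rev)
  have "(\<Prod>i=0..<B. real t - real B) \<le> (\<Prod>i=0..<B. real t - real i)"
    using assms by (intro prod_mono) auto
  then show "(real t - real B) ^ B \<le> real (t choose B) * fact B"
    unfolding eq by simp
  have "(\<Prod>i=0..<B. real t - real i) \<le> (\<Prod>i=0..<B. real t)"
    using assms by (intro prod_mono) auto
  then show "real (t choose B) * fact B \<le> real t ^ B"
    unfolding eq by simp
qed

text \<open>
  With \<open>y = q/n\<close> the lower bound is \<open>(1 - y) exp y \<ge> (1 - y) (1 + y) = 1 - y\<^sup>2\<close> raised to the power \<open>t\<close>, with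
  Bernoulli's inequality; the upper bound is \<open>1 - y \<le> exp (-y)\<close>.
\<close>

lemma one_minus_power_bounds:
  assumes "q \<le> n" "n > 0" "B \<le> t" and small: "real t * (real q)\<^sup>2 \<le> (real n)\<^sup>2"
  shows "1 - real t * (real q)\<^sup>2 / (real n)\<^sup>2 \<le> (1 - real q / real n) ^ (t - B) * exp (real q * (real t / real n))"
    and "(1 - real q / real n) ^ (t - B) * exp (real q * (real t / real n)) \<le> exp (real q * real B / real n)"
proof -
  define y where "y = real q / real n"
  have y: "0 \<le> y" "y \<le> 1" using assms by (auto simp: y_def)
  have "1 - real t * (real q)\<^sup>2 / (real n)\<^sup>2 = 1 + real t * (- y\<^sup>2)"
    by (simp add: y_def power_divide)
  also have "\<dots> \<le> (1 + (- y\<^sup>2)) ^ t"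
    by (rule Bernoulli_inequality) (use y in \<open>simp add: power_le_one\<close>)
  also have "1 + (- y\<^sup>2) = (1 - y) * (1 + y)"
    by (simp add: power2_eq_square algebra_simps)
  also have "((1 - y) * (1 + y)) ^ t \<le> ((1 - y) * exp y) ^ t"
    using y by (intro power_mono mult_left_mono) auto
  also have "\<dots> = (1 - y) ^ t * exp (real q * (real t / real n))"
    by (simp add: power_mult_distrib exp_of_nat_mult[symmetric] y_def mult_ac)
  also have "\<dots> \<le> (1 - y) ^ (t - B) * exp (real q * (real t / real n))"
    using y by (intro mult_right_mono power_decreasing) auto
  finally show "1 - real t * (real q)\<^sup>2 / (real n)\<^sup>2 \<le> (1 - real q / real n) ^ (t - B) * exp (real q * (real t / real n))"
    unfolding y_def .
  have "(1 - y) ^ (t - B) \<le> exp (- y) ^ (t - B)"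
    using y exp_ge_add_one_self[of "- y"] by (intro power_mono) auto
  also have "\<dots> = exp (- y * (real t - real B))"
    using assms(3) by (simp add: exp_of_nat_mult[symmetric] of_nat_diff mult_ac)
  finally have "(1 - y) ^ (t - B) * exp (real q * (real t / real n)) \<le> exp (- y * (real t - real B)) * exp (real q * (real t / real n))"
    by (rule mult_right_mono) simp
  also have "\<dots> = exp (real q * real B / real n)"
    using assms(2) by (simp add: mult_exp_exp y_def field_simps)
  finally show "(1 - real q / real n) ^ (t - B) * exp (real q * (real t / real n)) \<le> exp (real q * real B / real n)"
    unfolding y_def .
qed

text \<open>
  The multinomial probability is the product of the Poisson weights times a falling factorial over a power
  of \<open>t\<close> and times \<open>(1 - q/n)^(t - B) exp (q t / n)\<close>, where \<open>q = card C\<close>. The bounds depend on the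
  prescribed counts only through an upper bound of their sum, so they can be summed over all profiles.
\<close>

lemma multinomial_bounds:
  assumes C: "finite C" "card C \<le> n" and n: "n > 0" and t: "t > 0"
    and B: "sum b C \<le> B" "B \<le> t" and small: "real B ^ 2 \<le> t" "real t * (real (card C))\<^sup>2 \<le> (real n)\<^sup>2"
  defines "P \<equiv> (\<Prod>c\<in>C. poisson_weight (t / n) (b c))"
  shows "(1 - (real B)\<^sup>2 / t) * (1 - real t * (real (card C))\<^sup>2 / (real n)\<^sup>2) * P \<le> multinomial n t b C"
    and "multinomial n t b C \<le> exp (real (card C) * real B / n) * P"
proof -
  define q where "q = card C"
  define S where "S = sum b C"
  define f where "f = real (t choose S) * fact S / real t ^ S"
  define g where "g = (1 - real q / real n) ^ (t - S) * exp (real q * (real t / real n))"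
  have SB: "S \<le> B" and St: "S \<le> t" using B by (simp_all add: S_def)
  have P: "P = (real t / real n) ^ S * exp (- real q * (real t / real n)) / (\<Prod>c\<in>C. fact (b c))"
    using C unfolding P_def poisson_weight_def S_def q_def
    by (simp add: prod.distrib prod_dividef power_sum exp_of_nat_mult[symmetric] del: times_divide_eq_right)
  have P0: "P \<ge> 0" unfolding P_def by (intro prod_nonneg) (auto intro: poisson_weight_nonneg)
  have "(1 / real n) ^ S = (real t / real n) ^ S / real t ^ S"
    using t by (simp add: power_divide)
  then have eq: "multinomial n t b C = f * g * P"
    unfolding multinomial_def S_def[symmetric] q_def[symmetric] P f_def g_def
    by (simp add: exp_minus field_simps)
  have "1 - (real B)\<^sup>2 / t = 1 + real B * (- (real B / t))"
    by (simp add: power2_eq_square)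
  also have "\<dots> \<le> (1 + (- (real B / t))) ^ B"
    by (rule Bernoulli_inequality) (use B t in simp)
  also have "\<dots> \<le> (1 - real S / t) ^ B"
    using SB B t by (intro power_mono) (auto simp: divide_right_mono)
  also have "\<dots> \<le> (1 - real S / t) ^ S"
    using SB t St by (intro power_decreasing) auto
  also have "\<dots> = (real t - real S) ^ S / real t ^ S"
    using t by (simp add: power_divide[symmetric] diff_divide_distrib)
  also have "\<dots> \<le> f"
    unfolding f_def using falling_factorial_bounds[OF St] by (intro divide_right_mono) auto
  finally have f1: "1 - (real B)\<^sup>2 / t \<le> f" .
  have f2: "f \<le> 1"
    unfolding f_def using falling_factorial_bounds[OF St] t by (simp add: field_simps)
  have small': "real t * (real q)\<^sup>2 \<le> (real n)\<^sup>2" and q: "q \<le> n" using small C by (auto simp: q_def)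
  note g = one_minus_power_bounds[OF q n St small', folded g_def]
  have "(1 - (real B)\<^sup>2 / t) * (1 - real t * (real q)\<^sup>2 / (real n)\<^sup>2) \<le> f * g"
    using small small' t n by (intro mult_mono f1 g) (auto intro: order_trans[OF _ f1] order_trans[OF _ g(1)] simp: field_simps)
  then show "(1 - (real B)\<^sup>2 / t) * (1 - real t * (real (card C))\<^sup>2 / (real n)\<^sup>2) * P \<le> multinomial n t b C"
    unfolding eq q_def[symmetric] using P0 by (rule mult_right_mono)
  have g0: "0 \<le> g" unfolding g_def using q n by simp
  have "f * g \<le> 1 * g" using f2 g0 by (intro mult_right_mono)
  also have "\<dots> \<le> exp (real q * real S / real n)" using g(2) by simp
  also have "\<dots> \<le> exp (real q * real B / real n)"
    using SB n by (auto intro!: divide_right_mono mult_left_mono)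
  finally show "multinomial n t b C \<le> exp (real (card C) * real B / n) * P"
    unfolding eq q_def[symmetric] using P0 by (rule mult_right_mono)
qed

text \<open>
  The value of \<open>mixed_moment\<close> for independent Poisson counts: the number of choices of \<open>K\<close>, of \<open>c\<close> and of the
  \<open>j\<close> types short of \<open>m\<close> copies, times the Poisson weight of such a choice.
\<close>

definition mixed_moment_approx :: "nat \<Rightarrow> nat \<Rightarrow> nat \<Rightarrow> nat \<Rightarrow> nat \<Rightarrow> nat \<Rightarrow> real" where
  "mixed_moment_approx n m k t s j = real (n choose s) * (real n - real s) * real ((n - s - 1) choose j) *
    (poisson_weight (t/n) (m - 1) * poisson_weight (t/n) k ^ s * (\<Sum>i<m. poisson_weight (t/n) i) ^ j)"

context coupon
begin

text \<open>
  The condition of having fewer than \<open>m\<close> copies is split into the possible exact counts \<open>b\<close>, to which the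
  multinomial formula applies.
\<close>

lemma prob_profile_eq:
  assumes C: "C \<subseteq> {..<n}" and U: "U \<subseteq> {..<n} - C"
  shows "\<P>(\<omega> in M. (\<forall>v\<in>C. N t v \<omega> = a v) \<and> (\<forall>v\<in>U. N t v \<omega> < m)) =
    (\<Sum>b\<in>Pi\<^sub>E U (\<lambda>_. {..<m}). multinomial n t (\<lambda>v. if v \<in> C then a v else b v) (C \<union> U))"
proof -
  have fin: "finite C" "finite U" using C U by (auto intro: finite_subset)
  have "\<P>(\<omega> in M. (\<forall>v\<in>C. N t v \<omega> = a v) \<and> (\<forall>v\<in>U. N t v \<omega> < m)) =
    (\<Sum>b\<in>Pi\<^sub>E U (\<lambda>_. {..<m}). \<P>(\<omega> in M. \<forall>v\<in>C \<union> U. N t v \<omega> = (if v \<in> C then a v else b v)))"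
  proof (rule prob_sum)
    show "finite (Pi\<^sub>E U (\<lambda>_. {..<m}))" using fin by (intro finite_PiE) auto
    show "AE x in M. (\<forall>b\<in>Pi\<^sub>E U (\<lambda>_. {..<m}). (\<forall>v\<in>C \<union> U. N t v x = (if v \<in> C then a v else b v)) \<longrightarrow>
              (\<forall>v\<in>C. N t v x = a v) \<and> (\<forall>v\<in>U. N t v x < m)) \<and>
        ((\<forall>v\<in>C. N t v x = a v) \<and> (\<forall>v\<in>U. N t v x < m) \<longrightarrow>
         (\<exists>!b. b \<in> Pi\<^sub>E U (\<lambda>_. {..<m}) \<and> (\<forall>v\<in>C \<union> U. N t v x = (if v \<in> C then a v else b v))))"
    proof (intro AE_I2 conjI impI ballI)
      fix x b v
      assume *: "b \<in> Pi\<^sub>E U (\<lambda>_. {..<m})" "\<forall>v\<in>C \<union> U. N t v x = (if v \<in> C then a v else b v)"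
      { assume "v \<in> C" then show "N t v x = a v" using * by auto }
      { assume "v \<in> U" then show "N t v x < m" using * U by (auto simp: PiE_def Pi_def) }
    next
      fix x assume *: "(\<forall>v\<in>C. N t v x = a v) \<and> (\<forall>v\<in>U. N t v x < m)"
      show "\<exists>!b. b \<in> Pi\<^sub>E U (\<lambda>_. {..<m}) \<and> (\<forall>v\<in>C \<union> U. N t v x = (if v \<in> C then a v else b v))"
      proof (rule ex1I[of _ "restrict (\<lambda>v. N t v x) U"])
        fix b assume b: "b \<in> Pi\<^sub>E U (\<lambda>_. {..<m}) \<and> (\<forall>v\<in>C \<union> U. N t v x = (if v \<in> C then a v else b v))"
        show "b = restrict (\<lambda>v. N t v x) U"
        proof
          fix v
          show "b v = restrict (\<lambda>v. N t v x) U v"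
          proof (cases "v \<in> U")
            case True
            then have "v \<notin> C" using U by auto
            then show ?thesis using True b by auto
          next
            case False
            then show ?thesis using b by (auto simp: PiE_def extensional_def)
          qed
        qed
      qed (use * U in auto)
    qed
  qed auto
  also have "\<dots> = (\<Sum>b\<in>Pi\<^sub>E U (\<lambda>_. {..<m}). multinomial n t (\<lambda>v. if v \<in> C then a v else b v) (C \<union> U))"
    by (intro sum.cong refl prob_copies_eq) (use C U fin in auto)
  finally show ?thesis .
qed

context
  fixes m k t s j :: nat
  assumes t: "t > 0" and m: "m \<ge> 1" and q: "1 + s + j \<le> n"
    and B1: "(real (m + s * k + j * m))\<^sup>2 \<le> real t"
    and B2: "real t * (real (1 + s + j))\<^sup>2 \<le> (real n)\<^sup>2"
begin

lemma prob_profile_bounds: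
  assumes K: "K \<subseteq> {..<n}" "card K = s" and c: "c \<in> {..<n} - K"
    and U: "U \<subseteq> {..<n} - insert c K" "card U = j"
  defines "W \<equiv> poisson_weight (t/n) (m - 1) * poisson_weight (t/n) k ^ s * (\<Sum>i<m. poisson_weight (t/n) i) ^ j"
    and "P \<equiv> \<P>(\<omega> in M. (N t c \<omega> = m - 1 \<and> (\<forall>v\<in>K. N t v \<omega> = k)) \<and> (\<forall>v\<in>U. N t v \<omega> < m))"
  shows "(1 - (real (m + s * k + j * m))\<^sup>2 / t) * (1 - real t * (real (1 + s + j))\<^sup>2 / (real n)\<^sup>2) * W \<le> P"
    and "P \<le> exp (real (1 + s + j) * real (m + s * k + j * m) / n) * W"
proof -
  define a where "a v = (if v = c then m - 1 else k)" for v
  let ?C = "insert c K" and ?F = "Pi\<^sub>E U (\<lambda>_. {..<m})" and ?b = "\<lambda>b v. if v \<in> insert c K then a v else b v"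
  let ?w = "poisson_weight (t/n)"
  have fin: "finite K" "finite U" "finite (?C \<union> U)" using K U by (auto intro: finite_subset)
  have disj: "?C \<inter> U = {}" "c \<notin> K" using U c by auto
  have card: "card (?C \<union> U) = 1 + s + j"
    using disj fin K U c by (subst card_Un_disjoint) auto
  have Kc: "v \<in> K \<Longrightarrow> v \<noteq> c" for v using c by auto
  have "P = \<P>(\<omega> in M. (\<forall>v\<in>?C. N t v \<omega> = a v) \<and> (\<forall>v\<in>U. N t v \<omega> < m))"
    unfolding P_def by (intro arg_cong[where f = prob] Collect_cong) (auto simp: a_def dest: Kc)
  then have P: "P = (\<Sum>b\<in>?F. multinomial n t (?b b) (?C \<union> U))"
    using prob_profile_eq[of ?C U t a m] c K U by auto
  have sum_le: "sum (?b b) (?C \<union> U) \<le> m + s * k + j * m" if "b \<in> ?F" for b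
  proof -
    have "sum (?b b) (?C \<union> U) = sum (?b b) ?C + sum (?b b) U"
      using fin disj by (intro sum.union_disjoint) auto
    also have "sum (?b b) ?C = (m - 1) + (\<Sum>v\<in>K. k)"
      using fin disj Kc by (subst sum.insert) (auto simp: a_def intro!: sum.cong)
    also have "sum (?b b) U \<le> (\<Sum>v\<in>U. m)"
      using that disj by (intro sum_mono) (auto simp: PiE_def Pi_def less_imp_le)
    finally show ?thesis using K U by simp
  qed
  have prod: "(\<Prod>v\<in>?C \<union> U. ?w (?b b v)) = ?w (m - 1) * ?w k ^ s * (\<Prod>v\<in>U. ?w (b v))" if "b \<in> ?F" for b
  proof -
    have "(\<Prod>v\<in>?C \<union> U. ?w (?b b v)) = (\<Prod>v\<in>?C. ?w (?b b v)) * (\<Prod>v\<in>U. ?w (?b b v))"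
      using fin disj by (intro prod.union_disjoint) auto
    also have "(\<Prod>v\<in>?C. ?w (?b b v)) = ?w (m - 1) * (\<Prod>v\<in>K. ?w k)"
      using fin disj Kc by (subst prod.insert) (auto simp: a_def intro!: prod.cong)
    also have "(\<Prod>v\<in>U. ?w (?b b v)) = (\<Prod>v\<in>U. ?w (b v))"
      using disj by (intro prod.cong) auto
    finally show ?thesis using K by simp
  qed
  have W: "W = (\<Sum>b\<in>?F. \<Prod>v\<in>?C \<union> U. ?w (?b b v))"
  proof -
    have "(\<Sum>b\<in>?F. \<Prod>v\<in>U. ?w (b v)) = (\<Sum>i<m. ?w i) ^ j"
      using prod_sum_PiE[of U "\<lambda>_. {..<m}" "\<lambda>_. ?w"] fin U by simp
    then have "W = (\<Sum>b\<in>?F. ?w (m - 1) * ?w k ^ s * (\<Prod>v\<in>U. ?w (b v)))"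
      unfolding W_def by (simp add: sum_distrib_left[symmetric])
    also have "\<dots> = (\<Sum>b\<in>?F. \<Prod>v\<in>?C \<union> U. ?w (?b b v))"
      by (rule sum.cong[OF refl prod[symmetric]])
    finally show ?thesis .
  qed
  have Bt: "m + s * k + j * m \<le> t"
  proof -
    have "(m + s * k + j * m) ^ 2 \<le> t" using B1 by (simp only: of_nat_power[symmetric] of_nat_le_iff)
    moreover have "m + s * k + j * m \<le> (m + s * k + j * m) ^ 2" by (metis le_square power2_eq_square)
    ultimately show ?thesis by linarith
  qed
  note bounds = multinomial_bounds[OF fin(3) _ n_pos t sum_le Bt B1, unfolded card, OF q _ B2]
  show "(1 - (real (m + s * k + j * m))\<^sup>2 / t) * (1 - real t * (real (1 + s + j))\<^sup>2 / (real n)\<^sup>2) * W \<le> P"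
    unfolding W P sum_distrib_left by (intro sum_mono bounds)
  show "P \<le> exp (real (1 + s + j) * real (m + s * k + j * m) / n) * W"
    unfolding W P sum_distrib_left by (intro sum_mono bounds)
qed

lemma mixed_moment_bounds:
  shows "(1 - (real (m + s * k + j * m))\<^sup>2 / t) * (1 - real t * (real (1 + s + j))\<^sup>2 / (real n)\<^sup>2) * mixed_moment_approx n m k t s j
      \<le> mixed_moment m k t s j"
    and "mixed_moment m k t s j \<le> exp (real (1 + s + j) * real (m + s * k + j * m) / n) * mixed_moment_approx n m k t s j"
proof -
  let ?W = "poisson_weight (t/n) (m - 1) * poisson_weight (t/n) k ^ s * (\<Sum>i<m. poisson_weight (t/n) i) ^ j"
  have T: "x * mixed_moment_approx n m k t s j = (\<Sum>K | K \<subseteq> {..<n} \<and> card K = s. \<Sum>c\<in>{..<n} - K.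
       \<Sum>U | U \<subseteq> {..<n} - insert c K \<and> card U = j. x * ?W)" for x
  proof -
    have "(\<Sum>K | K \<subseteq> {..<n} \<and> card K = s. \<Sum>c\<in>{..<n} - K. \<Sum>U | U \<subseteq> {..<n} - insert c K \<and> card U = j. x * ?W)
      = (\<Sum>K | K \<subseteq> {..<n} \<and> card K = s. (real n - real s) * (real ((n - s - 1) choose j) * (x * ?W)))"
    proof (rule sum.cong[OF refl])
      fix K assume "K \<in> {K. K \<subseteq> {..<n} \<and> card K = s}"
      then have K: "K \<subseteq> {..<n}" "card K = s" and fin: "finite K" by (auto intro: finite_subset)
      have inner: "(\<Sum>U | U \<subseteq> {..<n} - insert c K \<and> card U = j. x * ?W) = real ((n - s - 1) choose j) * (x * ?W)"
        if c: "c \<in> {..<n} - K" for c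
      proof -
        have "card ({..<n} - insert c K) = n - s - 1"
          using K c fin by (subst card_Diff_subset) auto
        then show ?thesis by (simp add: n_subsets)
      qed
      have "(\<Sum>c\<in>{..<n} - K. \<Sum>U | U \<subseteq> {..<n} - insert c K \<and> card U = j. x * ?W) =
          (\<Sum>c\<in>{..<n} - K. real ((n - s - 1) choose j) * (x * ?W))"
        by (rule sum.cong[OF refl inner])
      also have "\<dots> = real (card ({..<n} - K)) * (real ((n - s - 1) choose j) * (x * ?W))"
        by simp
      also have "real (card ({..<n} - K)) = real n - real s"
        using K fin q by (subst card_Diff_subset) auto
      finally show "(\<Sum>c\<in>{..<n} - K. \<Sum>U | U \<subseteq> {..<n} - insert c K \<and> card U = j. x * ?W) =
          (real n - real s) * (real ((n - s - 1) choose j) * (x * ?W))" .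
    qed
    also have "\<dots> = real (n choose s) * ((real n - real s) * (real ((n - s - 1) choose j) * (x * ?W)))"
      by (simp add: n_subsets)
    finally show ?thesis
      by (simp add: mixed_moment_approx_def mult_ac)
  qed
  show "(1 - (real (m + s * k + j * m))\<^sup>2 / t) * (1 - real t * (real (1 + s + j))\<^sup>2 / (real n)\<^sup>2) * mixed_moment_approx n m k t s j
      \<le> mixed_moment m k t s j"
    unfolding T mixed_moment_def binomial_moment_def
    by (intro sum_mono prob_profile_bounds) auto
  show "mixed_moment m k t s j \<le> exp (real (1 + s + j) * real (m + s * k + j * m) / n) * mixed_moment_approx n m k t s j"
    unfolding T mixed_moment_def binomial_moment_def
    by (intro sum_mono prob_profile_bounds) auto
qed

end

end

section \<open>Local limit at the completing draw\<close>

text \<open>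
  Partial sums of even and odd order enclose \<open>p\<close>; letting first \<open>i\<close> and then the order tend to infinity
  closes the gap. For a fixed order the partial sum is finite, so that termwise convergence passes to it.
\<close>

lemma alternating_sandwich:
  fixes p :: "nat \<Rightarrow> real" and a :: "nat \<Rightarrow> nat \<Rightarrow> real"
  assumes lower: "\<And>q. odd q \<Longrightarrow> \<forall>\<^sub>F i in sequentially. (\<Sum>j\<le>q. (-1) ^ j * a j i) \<le> p i"
    and upper: "\<And>q. even q \<Longrightarrow> \<forall>\<^sub>F i in sequentially. p i \<le> (\<Sum>j\<le>q. (-1) ^ j * a j i)"
    and lim: "\<And>j. a j \<longlonglongrightarrow> A j"
    and L: "(\<lambda>j. (-1) ^ j * A j) sums L"
  shows "p \<longlonglongrightarrow> L"
proof (rule order_tendstoI)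
  have part: "(\<lambda>q. \<Sum>j\<le>q. (-1) ^ j * A j) \<longlonglongrightarrow> L"
    using L by (simp add: sums_def_le)
  have partial: "(\<lambda>i. \<Sum>j\<le>q. (-1) ^ j * a j i) \<longlonglongrightarrow> (\<Sum>j\<le>q. (-1) ^ j * A j)" for q
    by (intro tendsto_sum tendsto_mult lim tendsto_const)
  fix y assume "y < L"
  from order_tendstoD(1)[OF part this] obtain q0 where q0: "\<And>q. q \<ge> q0 \<Longrightarrow> y < (\<Sum>j\<le>q. (-1) ^ j * A j)"
    by (auto simp: eventually_sequentially)
  \<comment> \<open>An odd order past \<open>q0\<close>, where the partial sums are lower bounds.\<close>
  define q where "q = 2 * q0 + 1"
  have "\<forall>\<^sub>F i in sequentially. y < (\<Sum>j\<le>q. (-1) ^ j * a j i)"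
    by (rule order_tendstoD(1)[OF partial q0]) (simp add: q_def)
  moreover have "\<forall>\<^sub>F i in sequentially. (\<Sum>j\<le>q. (-1) ^ j * a j i) \<le> p i"
    by (rule lower) (simp add: q_def)
  ultimately show "\<forall>\<^sub>F i in sequentially. y < p i"
    by eventually_elim linarith
next
  have part: "(\<lambda>q. \<Sum>j\<le>q. (-1) ^ j * A j) \<longlonglongrightarrow> L"
    using L by (simp add: sums_def_le)
  have partial: "(\<lambda>i. \<Sum>j\<le>q. (-1) ^ j * a j i) \<longlonglongrightarrow> (\<Sum>j\<le>q. (-1) ^ j * A j)" for q
    by (intro tendsto_sum tendsto_mult lim tendsto_const)
  fix y assume "L < y"
  from order_tendstoD(2)[OF part this] obtain q0 where q0: "\<And>q. q \<ge> q0 \<Longrightarrow> (\<Sum>j\<le>q. (-1) ^ j * A j) < y"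
    by (auto simp: eventually_sequentially)
  \<comment> \<open>An even order, where they are upper bounds.\<close>
  define q where "q = 2 * q0"
  have "\<forall>\<^sub>F i in sequentially. (\<Sum>j\<le>q. (-1) ^ j * a j i) < y"
    by (rule order_tendstoD(2)[OF partial q0]) (simp add: q_def)
  moreover have "\<forall>\<^sub>F i in sequentially. p i \<le> (\<Sum>j\<le>q. (-1) ^ j * a j i)"
    by (rule upper) (simp add: q_def)
  ultimately show "\<forall>\<^sub>F i in sequentially. p i < y"
    by eventually_elim linarith
qed

lemma alternating_exp_sums: "(\<lambda>j. (-1) ^ j * (c * x ^ j / fact j)) sums (c * exp (- x :: real))"
proof -
  have "(\<lambda>j. c * ((- x) ^ j /\<^sub>R fact j)) sums (c * exp (- x))"
    by (intro sums_mult exp_converges)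
  moreover have "c * ((- x) ^ j /\<^sub>R fact j) = (-1) ^ j * (c * x ^ j / fact j)" for j
    by (simp add: power_minus[of x] field_simps)
  ultimately show ?thesis by simp
qed

lemma choose_over_power_limit:
  "(\<lambda>n. real ((n - a) choose j) / real n ^ j) \<longlonglongrightarrow> 1 / fact j"
proof -
  have "(\<lambda>n. (\<Prod>i=0..<j. (real n - real a - real i) / real n) / fact j) \<longlonglongrightarrow> (\<Prod>i=0..<j. 1) / fact j"
    by (intro tendsto_divide tendsto_prod tendsto_const) (real_asymp, simp)
  moreover have "\<forall>\<^sub>F n in sequentially. (\<Prod>i=0..<j. (real n - real a - real i) / real n) / fact j
      = real ((n - a) choose j) / real n ^ j"
    using eventually_ge_at_top[of a]
  proof eventually_elim
    case (elim n)
    then show ?case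
      by (simp add: binomial_gbinomial gbinomial_prod_rev of_nat_diff prod_dividef)
  qed
  ultimately show ?thesis
    by (simp add: Lim_transform_eventually)
qed

locale coupon_sequence =
  fixes M :: "nat \<Rightarrow> 'a measure" and n :: "nat \<Rightarrow> nat" and X :: "nat \<Rightarrow> nat \<Rightarrow> 'a \<Rightarrow> nat"
    and m :: nat and k :: "nat \<Rightarrow> nat"
  assumes coupon: "coupon (M i) (n i) (X i)"
    and m_ge_1: "m \<ge> 1"
    and n_lim: "filterlim n at_top sequentially"
    and k_lim: "filterlim k at_top sequentially"
begin

abbreviation tmoment :: "nat \<Rightarrow> nat \<Rightarrow> nat \<Rightarrow> real" where
  "tmoment i t s \<equiv> coupon.ton_moment (M i) (n i) (X i) m (k i) t s"

abbreviation mmoment :: "nat \<Rightarrow> nat \<Rightarrow> nat \<Rightarrow> nat \<Rightarrow> real" where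
  "mmoment i t s j \<equiv> coupon.mixed_moment (M i) (n i) (X i) m (k i) t s j"

definition mean_tons :: "nat \<Rightarrow> nat \<Rightarrow> real" where
  "mean_tons i t = n i * poisson_weight (t / n i) (k i)"

abbreviation completes_with :: "nat \<Rightarrow> nat \<Rightarrow> (nat \<Rightarrow> bool) \<Rightarrow> real" where
  "completes_with i t P \<equiv> \<P>(\<omega> in M i. coupon.completes (n i) (X i) m t \<omega> \<and> P (num_tons m (n i) (X i) (k i) \<omega>))"

lemma eventually_n_ge: "\<forall>\<^sub>F i in sequentially. c \<le> n i"
  using n_lim by (simp add: filterlim_at_top)

lemma eventually_k_ge: "\<forall>\<^sub>F i in sequentially. c \<le> k i"
  using k_lim by (simp add: filterlim_at_top)

context
  fixes t :: "nat \<Rightarrow> nat" and \<mu> :: real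
  assumes t_pos: "\<forall>\<^sub>F i in sequentially. t i > 0"
    and k2t: "(\<lambda>i. (real (k i))\<^sup>2 / t i) \<longlonglongrightarrow> 0"
    and kn: "(\<lambda>i. real (k i) / n i) \<longlonglongrightarrow> 0"
    and tn2: "(\<lambda>i. real (t i) / (real (n i))\<^sup>2) \<longlonglongrightarrow> 0"
    and mu1: "(\<lambda>i. n i * poisson_weight (t i / n i) (m - 1)) \<longlonglongrightarrow> \<mu>"
    and mu2: "(\<lambda>i. n i * (\<Sum>l<m. poisson_weight (t i / n i) l)) \<longlonglongrightarrow> \<mu>"
begin

lemma mean_tons_pos: "\<forall>\<^sub>F i in sequentially. mean_tons i (t i) > 0"
  using t_pos eventually_n_ge[of 1]
  by eventually_elim (simp add: mean_tons_def poisson_weight_def)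

lemma mixed_moment_approx_limit:
  "(\<lambda>i. mixed_moment_approx (n i) m (k i) (t i) s j / mean_tons i (t i) ^ s)
     \<longlonglongrightarrow> \<mu> / fact s * \<mu> ^ j / fact j"
proof -
  have "(\<lambda>i. (real ((n i - 0) choose s) / real (n i) ^ s) * ((real (n i) - real s) / real (n i)) *
       (real ((n i - (s + 1)) choose j) / real (n i) ^ j) * (n i * poisson_weight (t i / n i) (m - 1)) *
       (n i * (\<Sum>l<m. poisson_weight (t i / n i) l)) ^ j) \<longlonglongrightarrow> (1 / fact s) * 1 * (1 / fact j) * \<mu> * \<mu> ^ j"
    by (intro tendsto_mult mu1 mu2 tendsto_power filterlim_compose[OF choose_over_power_limit n_lim]
        filterlim_compose[OF _ n_lim, of "\<lambda>n. (real n - real s) / real n"]) real_asymp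
  moreover have "\<forall>\<^sub>F i in sequentially. (real ((n i - 0) choose s) / real (n i) ^ s) * ((real (n i) - real s) / real (n i)) *
       (real ((n i - (s + 1)) choose j) / real (n i) ^ j) * (n i * poisson_weight (t i / n i) (m - 1)) *
       (n i * (\<Sum>l<m. poisson_weight (t i / n i) l)) ^ j
      = mixed_moment_approx (n i) m (k i) (t i) s j / mean_tons i (t i) ^ s"
    using mean_tons_pos eventually_n_ge[of 1]
  proof eventually_elim
    case (elim i)
    then have "poisson_weight (t i / n i) (k i) \<noteq> 0" by (auto simp: mean_tons_def)
    moreover have "a / N ^ s * ((N - real s) / N) * (b / N ^ j) * (N * p) * (N * f) ^ j =
        a * (N - real s) * b * (p * w ^ s * f ^ j) / (N * w) ^ s" if "N > 0" "w \<noteq> 0" for a b p f w N :: real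
      using that by (simp add: power_mult_distrib)
    ultimately show ?case
      using elim(2) unfolding mixed_moment_approx_def mean_tons_def by simp
  qed
  ultimately show ?thesis
    by (simp add: Lim_transform_eventually mult_ac)
qed

text \<open>
  The total count prescribed by a profile is \<open>O(k)\<close>, so the relative errors of the Poisson approximation are
  \<open>O(k\<^sup>2/t)\<close>, \<open>O(t/n\<^sup>2)\<close> and \<open>O(k/n)\<close>. The normalisation by a power of the mean number of \<open>k\<close>-tons
  lets that mean tend to \<open>0\<close>, to a positive limit or to infinity.
\<close>

lemma mixed_moment_limit:
  "(\<lambda>i. mmoment i (t i) s j / mean_tons i (t i) ^ s) \<longlonglongrightarrow> \<mu> / fact s * \<mu> ^ j / fact j"
proof (rule tendsto_sandwich)
  let ?B = "\<lambda>i. real (m + s * k i + j * m)" and ?q = "real (1 + s + j)"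
  let ?A = "\<lambda>i. mixed_moment_approx (n i) m (k i) (t i) s j / mean_tons i (t i) ^ s"
  let ?lo = "\<lambda>i. (1 - (?B i)\<^sup>2 / t i) * (1 - real (t i) * ?q\<^sup>2 / (real (n i))\<^sup>2)"
  let ?hi = "\<lambda>i. exp (?q * ?B i / n i)"
  \<comment> \<open>Once \<open>k \<ge> 1\<close>, the total count prescribed by a profile is at most \<open>c k\<close>.\<close>
  define c where "c = real (m + s + j * m)"
  have Bc: "\<forall>\<^sub>F i in sequentially. ?B i \<le> c * k i"
    using eventually_k_ge[of 1]
  proof eventually_elim
    case (elim i)
    have "m + s * k i + j * m \<le> m * k i + s * k i + j * m * k i"
      using elim by (intro add_mono) auto
    then have "m + s * k i + j * m \<le> (m + s + j * m) * k i" by (simp add: algebra_simps)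
    then show ?case unfolding c_def by (simp only: of_nat_mult[symmetric] of_nat_le_iff)
  qed
  have B2: "(\<lambda>i. (?B i)\<^sup>2 / t i) \<longlonglongrightarrow> 0"
  proof (rule tendsto_sandwich[OF _ _ tendsto_const])
    show "\<forall>\<^sub>F i in sequentially. 0 \<le> (?B i)\<^sup>2 / t i" by simp
    show "\<forall>\<^sub>F i in sequentially. (?B i)\<^sup>2 / t i \<le> c\<^sup>2 * ((real (k i))\<^sup>2 / t i)"
      using Bc
    proof eventually_elim
      case (elim i)
      then have "(?B i)\<^sup>2 \<le> (c * k i)\<^sup>2" by (intro power_mono) auto
      then show ?case by (simp add: power_mult_distrib divide_right_mono)
    qed
    show "(\<lambda>i. c\<^sup>2 * ((real (k i))\<^sup>2 / t i)) \<longlonglongrightarrow> 0"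
      by (rule tendsto_mult_right_zero[OF k2t])
  qed
  have Bn: "(\<lambda>i. ?q * ?B i / n i) \<longlonglongrightarrow> 0"
  proof (rule tendsto_sandwich[OF _ _ tendsto_const])
    show "\<forall>\<^sub>F i in sequentially. 0 \<le> ?q * ?B i / n i" by simp
    show "\<forall>\<^sub>F i in sequentially. ?q * ?B i / n i \<le> ?q * c * (real (k i) / n i)"
      using Bc
    proof eventually_elim
      case (elim i)
      then have "?q * ?B i / n i \<le> ?q * (c * k i) / n i" by (intro divide_right_mono mult_left_mono) auto
      then show ?case by simp
    qed
    show "(\<lambda>i. ?q * c * (real (k i) / n i)) \<longlonglongrightarrow> 0"
      by (rule tendsto_mult_right_zero[OF kn])
  qed
  have q2: "(\<lambda>i. real (t i) * ?q\<^sup>2 / (real (n i))\<^sup>2) \<longlonglongrightarrow> 0"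
    using tendsto_mult_left_zero[OF tn2, of "?q\<^sup>2"] by (simp only: times_divide_eq_left)
  have "\<forall>\<^sub>F i in sequentially. (?B i)\<^sup>2 / t i < 1" "\<forall>\<^sub>F i in sequentially. real (t i) * ?q\<^sup>2 / (real (n i))\<^sup>2 < 1"
    using order_tendstoD(2)[OF B2, of 1] order_tendstoD(2)[OF q2, of 1] by auto
  then have ev: "\<forall>\<^sub>F i in sequentially. ?lo i * ?A i \<le> mmoment i (t i) s j / mean_tons i (t i) ^ s \<and>
     mmoment i (t i) s j / mean_tons i (t i) ^ s \<le> ?hi i * ?A i"
    using eventually_n_ge[of "1 + s + j"] t_pos mean_tons_pos
  proof eventually_elim
    case (elim i)
    then have B1: "(?B i)\<^sup>2 \<le> t i" and q1: "real (t i) * ?q\<^sup>2 \<le> (real (n i))\<^sup>2"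
      by (simp_all only: divide_less_eq_1 of_nat_0_less_iff zero_less_power) (auto simp: divide_less_eq_1 less_imp_le split: if_splits)
    note b = coupon.mixed_moment_bounds[OF coupon elim(4) m_ge_1 elim(3) B1 q1]
    have r: "0 \<le> mean_tons i (t i) ^ s" using elim(5) by simp
    from divide_right_mono[OF b(1) r] divide_right_mono[OF b(2) r] show ?case
      by (simp only: times_divide_eq_right)
  qed
  then show "\<forall>\<^sub>F i in sequentially. ?lo i * ?A i \<le> mmoment i (t i) s j / mean_tons i (t i) ^ s"
    by (rule eventually_mono) simp
  from ev show "\<forall>\<^sub>F i in sequentially. mmoment i (t i) s j / mean_tons i (t i) ^ s \<le> ?hi i * ?A i"
    by (rule eventually_mono) simp
  have "(\<lambda>i. ?lo i * ?A i) \<longlonglongrightarrow> ((1 - 0) * (1 - 0)) * (\<mu> / fact s * \<mu> ^ j / fact j)"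
    by (intro tendsto_mult tendsto_diff tendsto_const B2 q2 mixed_moment_approx_limit)
  then show "(\<lambda>i. ?lo i * ?A i) \<longlonglongrightarrow> \<mu> / fact s * \<mu> ^ j / fact j" by simp
  have "(\<lambda>i. ?hi i * ?A i) \<longlonglongrightarrow> exp 0 * (\<mu> / fact s * \<mu> ^ j / fact j)"
    by (intro tendsto_mult tendsto_exp Bn mixed_moment_approx_limit)
  then show "(\<lambda>i. ?hi i * ?A i) \<longlonglongrightarrow> \<mu> / fact s * \<mu> ^ j / fact j" by simp
qed

text \<open>
  Inclusion and exclusion over the types short of \<open>m\<close> copies: \<open>\<mu> / s! \<cdot> \<Sum> (-\<mu>)^j / j!\<close>. One factor \<open>\<mu>\<close>
  comes from the type that is about to be completed, the exponential from the absence of others.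
\<close>

lemma ton_moment_limit:
  "(\<lambda>i. n i * tmoment i (t i) s / mean_tons i (t i) ^ s) \<longlonglongrightarrow> \<mu> * exp (- \<mu>) / fact s"
proof (rule alternating_sandwich)
  fix q :: nat
  have eq: "(\<Sum>j\<le>q. (-1) ^ j * (mmoment i (t i) s j / mean_tons i (t i) ^ s)) =
      (\<Sum>j\<le>q. (-1) ^ j * mmoment i (t i) s j) / mean_tons i (t i) ^ s" for i
    by (simp add: sum_divide_distrib)
  show "\<forall>\<^sub>F i in sequentially. (\<Sum>j\<le>q. (-1) ^ j * (mmoment i (t i) s j / mean_tons i (t i) ^ s)) \<le> n i * tmoment i (t i) s / mean_tons i (t i) ^ s" if "odd q"
    unfolding eq using mean_tons_pos eventually_k_ge[of m]
    by eventually_elim (intro divide_right_mono coupon.ton_moment_lower[OF coupon] that m_ge_1, auto)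
  show "\<forall>\<^sub>F i in sequentially. n i * tmoment i (t i) s / mean_tons i (t i) ^ s \<le> (\<Sum>j\<le>q. (-1) ^ j * (mmoment i (t i) s j / mean_tons i (t i) ^ s))" if "even q"
    unfolding eq using mean_tons_pos eventually_k_ge[of m]
    by eventually_elim (intro divide_right_mono coupon.ton_moment_upper[OF coupon] that m_ge_1, auto)
  show "(\<lambda>i. mmoment i (t i) s j / mean_tons i (t i) ^ s) \<longlonglongrightarrow> \<mu> / fact s * \<mu> ^ j / fact j" for j
    by (rule mixed_moment_limit)
  show "(\<lambda>j. (-1) ^ j * (\<mu> / fact s * \<mu> ^ j / fact j)) sums (\<mu> * exp (- \<mu>) / fact s)"
    using alternating_exp_sums[of "\<mu> / fact s" \<mu>] by simp
qed

text \<open>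
  Inclusion and exclusion over the \<open>k\<close>-tons recovers the distribution of their number from its binomial
  moments, and these are \<open>\<mu> exp (-\<mu>)\<close> times those of the Poisson distribution of mean \<open>\<rho>\<close>.
\<close>

lemma local_limit_bounded:
  assumes "(\<lambda>i. mean_tons i (t i)) \<longlonglongrightarrow> \<rho>"
  shows "(\<lambda>i. n i * completes_with i (t i) (\<lambda>S. S = s)) \<longlonglongrightarrow> \<mu> * exp (- \<mu>) * (\<rho> ^ s / fact s * exp (- \<rho>))"
proof (rule alternating_sandwich)
  fix q :: nat
  have eq: "(\<Sum>j\<le>q. (-1) ^ j * (real ((s + j) choose s) * (n i * tmoment i (t i) (s + j)))) =
     n i * (\<Sum>j\<le>q. (-1) ^ j * real ((s + j) choose s) * tmoment i (t i) (s + j))" for i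
    by (simp add: sum_distrib_left mult_ac)
  show "\<forall>\<^sub>F i in sequentially. (\<Sum>j\<le>q. (-1) ^ j * (real ((s + j) choose s) * (n i * tmoment i (t i) (s + j)))) \<le> n i * completes_with i (t i) (\<lambda>S. S = s)" if "odd q"
    unfolding eq using eventually_k_ge[of "Suc m"]
    by eventually_elim (intro mult_left_mono coupon.num_tons_lower[OF coupon] that m_ge_1, auto)
  show "\<forall>\<^sub>F i in sequentially. n i * completes_with i (t i) (\<lambda>S. S = s) \<le> (\<Sum>j\<le>q. (-1) ^ j * (real ((s + j) choose s) * (n i * tmoment i (t i) (s + j))))" if "even q"
    unfolding eq using eventually_k_ge[of "Suc m"]
    by eventually_elim (intro mult_left_mono coupon.num_tons_upper[OF coupon] that m_ge_1, auto)
  show "(\<lambda>i. real ((s + j) choose s) * (n i * tmoment i (t i) (s + j))) \<longlonglongrightarrow> \<mu> * exp (- \<mu>) * (\<rho> ^ s / fact s) * \<rho> ^ j / fact j" for j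
  proof -
    have "(\<lambda>i. real ((s + j) choose s) * ((n i * tmoment i (t i) (s + j) / mean_tons i (t i) ^ (s + j)) * mean_tons i (t i) ^ (s + j)))
        \<longlonglongrightarrow> real ((s + j) choose s) * (\<mu> * exp (- \<mu>) / fact (s + j) * \<rho> ^ (s + j))"
      by (intro tendsto_mult tendsto_power ton_moment_limit assms tendsto_const)
    moreover have "real ((s + j) choose s) * (\<mu> * exp (- \<mu>) / fact (s + j) * \<rho> ^ (s + j)) = \<mu> * exp (- \<mu>) * (\<rho> ^ s / fact s) * \<rho> ^ j / fact j"
      by (simp add: binomial_fact power_add field_simps)
    moreover have "\<forall>\<^sub>F i in sequentially. real ((s + j) choose s) * ((n i * tmoment i (t i) (s + j) / mean_tons i (t i) ^ (s + j)) * mean_tons i (t i) ^ (s + j)) = real ((s + j) choose s) * (n i * tmoment i (t i) (s + j))"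
      using mean_tons_pos by eventually_elim simp
    ultimately show ?thesis
      by (simp add: Lim_transform_eventually)
  qed
  show "(\<lambda>j. (-1) ^ j * (\<mu> * exp (- \<mu>) * (\<rho> ^ s / fact s) * \<rho> ^ j / fact j)) sums (\<mu> * exp (- \<mu>) * (\<rho> ^ s / fact s * exp (- \<rho>)))"
    using alternating_exp_sums[of "\<mu> * exp (- \<mu>) * (\<rho> ^ s / fact s)" \<rho>] by (simp only: mult.assoc)
qed

text \<open>
  When the mean \<open>r\<close> tends to infinity, the number of \<open>k\<close>-tons divided by \<open>r\<close> has on the event of completion
  asymptotically the first two moments of the constant 1, so \<open>second_moment_lower\<close> loses nothing in the limit.
\<close>

lemma local_limit_unbounded:
  assumes r: "filterlim (\<lambda>i. mean_tons i (t i)) at_top sequentially"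
  shows "\<exists>L. L \<longlonglongrightarrow> \<mu> * exp (- \<mu>) \<and> (\<forall>\<^sub>F i in sequentially. L i \<le> n i * completes_with i (t i) (\<lambda>S. S > 0))"
proof (intro exI conjI)
  let ?r = "\<lambda>i. mean_tons i (t i)"
  let ?m = "\<lambda>i s. n i * tmoment i (t i) s / ?r i ^ s"
  have "(\<lambda>i. 2 * ?m i 1 - ?m i 1 * inverse (?r i) - 2 * ?m i 2) \<longlonglongrightarrow>
      2 * (\<mu> * exp (- \<mu>) / fact 1) - (\<mu> * exp (- \<mu>) / fact 1) * 0 - 2 * (\<mu> * exp (- \<mu>) / fact 2)"
    by (intro tendsto_diff tendsto_mult ton_moment_limit tendsto_const tendsto_inverse_0_at_top[OF r])
  then show "(\<lambda>i. 2 * ?m i 1 - ?m i 1 * inverse (?r i) - 2 * ?m i 2) \<longlonglongrightarrow> \<mu> * exp (- \<mu>)" by simp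
  show "\<forall>\<^sub>F i in sequentially. 2 * ?m i 1 - ?m i 1 * inverse (?r i) - 2 * ?m i 2 \<le> n i * completes_with i (t i) (\<lambda>S. S > 0)"
    using mean_tons_pos eventually_k_ge[of "Suc m"]
  proof eventually_elim
    case (elim i)
    have "n i * (2 * (tmoment i (t i) 1 / ?r i) - (tmoment i (t i) 1 / ?r i) / ?r i - 2 * (tmoment i (t i) 2 / (?r i)\<^sup>2))
        \<le> n i * completes_with i (t i) (\<lambda>S. S > 0)"
      by (intro mult_left_mono coupon.num_tons_positive_lower[OF coupon] m_ge_1) (use elim in auto)
    then show ?case
      by (simp add: right_diff_distrib divide_inverse mult_ac)
  qed
qed

end

end

section \<open>Asymptotics in the critical window\<close>

text \<open>
  Here \<open>n\<close> types have received \<open>t\<close> coupons, where \<open>t\<close> lies at position \<open>x\<close> in the window in which the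
  collection is completed. The correction \<open>\<delta>\<close> covers at once the bounded sequence of the first assertion and the
  sequences \<open>g\<close> and \<open>-g\<close> of the other two.
\<close>

locale critical_window =
  fixes n t k :: "nat \<Rightarrow> nat" and m :: nat and \<delta> :: "nat \<Rightarrow> real" and x :: real
  assumes m_ge_1: "m \<ge> 1"
    and n_lim: "filterlim n at_top sequentially"
    and k_eq: "\<And>i. real (k i) = exp 1 * ln (n i) + ((exp 1 - 1) * (real m - 1) - 1 / 2) * ln (ln (n i)) + \<delta> i"
    and delta_small: "(\<lambda>i. \<delta> i / ln (ln (n i))) \<longlonglongrightarrow> 0"
    and t_lim: "(\<lambda>i. real (t i) / n i - ln (n i) - (real m - 1) * ln (ln (n i))) \<longlonglongrightarrow> x"
begin

definition L where "L i = ln (real (n i))"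
definition l where "l i = ln (L i)"
text \<open>
  The mean number \<open>lam\<close> of copies of a type is \<open>L + (m - 1) l + theta\<close> with \<open>theta \<rightarrow> x\<close>.
\<close>

definition lam where "lam i = real (t i) / real (n i)"
definition theta where "theta i = lam i - L i - (real m - 1) * l i"

lemma n_limits:
  shows "(\<lambda>i. l i / L i) \<longlonglongrightarrow> 0" "(\<lambda>i. L i / n i) \<longlonglongrightarrow> 0" "(\<lambda>i. (l i)\<^sup>2 / L i) \<longlonglongrightarrow> 0"
    "(\<lambda>i. 1 / L i) \<longlonglongrightarrow> 0" "(\<lambda>i. 1 / l i) \<longlonglongrightarrow> 0" "filterlim L at_top sequentially"
  unfolding l_def L_def
  by (rule filterlim_compose[OF _ n_lim]; real_asymp)+

lemma large: "\<forall>\<^sub>F i in sequentially. L i > 1 \<and> l i > 0 \<and> n i > 0"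
proof -
  have "\<forall>\<^sub>F i in sequentially. n i > 0"
    by (rule eventually_compose_filterlim[OF eventually_gt_at_top n_lim])
  moreover have "\<forall>\<^sub>F i in sequentially. L i > 1"
    using n_limits(6) by (simp add: filterlim_at_top_dense)
  ultimately show ?thesis
    by eventually_elim (simp add: l_def)
qed

lemma theta_limit: "theta \<longlonglongrightarrow> x"
  using t_lim unfolding theta_def[abs_def] lam_def L_def l_def .

lemma over_L_limit:
  assumes "f \<longlonglongrightarrow> (c :: real)"
  shows "(\<lambda>i. f i / L i) \<longlonglongrightarrow> 0"
  using tendsto_mult[OF assms n_limits(4)] by simp

lemma delta_over_L: "(\<lambda>i. \<delta> i / L i) \<longlonglongrightarrow> 0"
proof -
  have "(\<lambda>i. (\<delta> i / l i) * (l i / L i)) \<longlonglongrightarrow> 0 * 0"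
    by (intro tendsto_mult n_limits) (use delta_small in \<open>simp add: l_def L_def\<close>)
  moreover have "\<forall>\<^sub>F i in sequentially. (\<delta> i / l i) * (l i / L i) = \<delta> i / L i"
    using large by eventually_elim simp
  ultimately show ?thesis by (simp add: Lim_transform_eventually)
qed

lemma lam_over_L: "(\<lambda>i. lam i / L i) \<longlonglongrightarrow> 1"
proof -
  have "(\<lambda>i. 1 + (real m - 1) * (l i / L i) + theta i / L i) \<longlonglongrightarrow> 1 + (real m - 1) * 0 + 0"
    by (intro tendsto_add tendsto_mult tendsto_const n_limits over_L_limit[OF theta_limit])
  moreover have "\<forall>\<^sub>F i in sequentially. 1 + (real m - 1) * (l i / L i) + theta i / L i = lam i / L i"
    using large by eventually_elim (simp add: theta_def field_simps)
  ultimately show ?thesis by (simp add: Lim_transform_eventually)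
qed

lemma k_over_L: "(\<lambda>i. k i / L i) \<longlonglongrightarrow> exp 1"
proof -
  let ?c = "(exp 1 - 1) * (real m - 1) - 1 / 2"
  have "(\<lambda>i. exp 1 + ?c * (l i / L i) + \<delta> i / L i) \<longlonglongrightarrow> exp 1 + ?c * 0 + 0"
    by (intro tendsto_add tendsto_mult tendsto_const n_limits delta_over_L)
  moreover have "\<forall>\<^sub>F i in sequentially. exp 1 + ?c * (l i / L i) + \<delta> i / L i = k i / L i"
    using large unfolding k_eq L_def[symmetric] l_def[symmetric] by eventually_elim (simp add: add_divide_distrib)
  ultimately show ?thesis by (simp add: Lim_transform_eventually)
qed

lemma k_lim_real: "filterlim (\<lambda>i. real (k i)) at_top sequentially"
proof -
  have "filterlim (\<lambda>i. (k i / L i) * L i) at_top sequentially"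
    by (rule filterlim_tendsto_pos_mult_at_top[OF k_over_L _ n_limits(6)]) simp
  moreover have "\<forall>\<^sub>F i in sequentially. (k i / L i) * L i = k i"
    using large by eventually_elim simp
  ultimately show ?thesis
    by (simp add: filterlim_cong)
qed

lemma k_lim: "filterlim k at_top sequentially"
  unfolding filterlim_at_top
proof
  fix c
  have "\<forall>\<^sub>F i in sequentially. real c \<le> real (k i)"
    using k_lim_real unfolding filterlim_at_top by blast
  then show "\<forall>\<^sub>F i in sequentially. c \<le> k i" by simp
qed

lemma lam_pos: "\<forall>\<^sub>F i in sequentially. lam i > 0"
  using order_tendstoD(1)[OF lam_over_L zero_less_one] large
  by eventually_elim (simp_all add: zero_less_divide_iff)

lemma t_pos: "\<forall>\<^sub>F i in sequentially. t i > 0"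
  using lam_pos by eventually_elim (auto simp: lam_def zero_less_divide_iff)

lemma k_over_n: "(\<lambda>i. real (k i) / n i) \<longlonglongrightarrow> 0"
proof -
  have "(\<lambda>i. (k i / L i) * (L i / n i)) \<longlonglongrightarrow> exp 1 * 0"
    by (intro tendsto_mult k_over_L n_limits)
  moreover have "\<forall>\<^sub>F i in sequentially. (k i / L i) * (L i / n i) = k i / n i"
    using large by eventually_elim simp
  ultimately show ?thesis by (simp add: Lim_transform_eventually)
qed

lemma t_over_n2: "(\<lambda>i. real (t i) / (real (n i))\<^sup>2) \<longlonglongrightarrow> 0"
proof -
  have "(\<lambda>i. (lam i / L i) * (L i / n i)) \<longlonglongrightarrow> 1 * 0"
    by (intro tendsto_mult lam_over_L n_limits)
  moreover have "\<forall>\<^sub>F i in sequentially. (lam i / L i) * (L i / n i) = real (t i) / (real (n i))\<^sup>2"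
    using large by eventually_elim (simp add: lam_def power2_eq_square)
  ultimately show ?thesis by (simp add: Lim_transform_eventually)
qed

lemma k2_over_t: "(\<lambda>i. (real (k i))\<^sup>2 / t i) \<longlonglongrightarrow> 0"
proof -
  have "(\<lambda>i. (k i / L i)\<^sup>2 * (L i / n i) / (lam i / L i)) \<longlonglongrightarrow> (exp 1)\<^sup>2 * 0 / 1"
    by (intro tendsto_mult tendsto_power tendsto_divide k_over_L lam_over_L n_limits) simp
  moreover have "\<forall>\<^sub>F i in sequentially. (k i / L i)\<^sup>2 * (L i / n i) / (lam i / L i) = (real (k i))\<^sup>2 / t i"
    using large t_pos by eventually_elim (simp add: lam_def power2_eq_square field_simps)
  ultimately show ?thesis by (simp add: Lim_transform_eventually)
qed

lemma n_exp_lam: "\<forall>\<^sub>F i in sequentially. n i * exp (- lam i) = exp (- theta i) * exp (- ((real m - 1) * l i))"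
  using large
proof eventually_elim
  case (elim i)
  have "lam i = theta i + (real m - 1) * l i + L i" by (simp add: theta_def)
  then have "exp (- lam i) = exp (- theta i) * exp (- ((real m - 1) * l i)) * exp (- L i)"
    by (simp add: mult_exp_exp)
  moreover have "exp (- L i) = 1 / n i" using elim by (simp add: L_def exp_minus inverse_eq_divide)
  ultimately show ?case using elim by simp
qed

text \<open>
  Since \<open>n exp (-lam) = exp (-theta) / L^(m - 1)\<close>, the Poisson weight of \<open>j\<close> times \<open>n\<close> is of order
  \<open>L^(j - (m - 1))\<close>, so that \<open>m - 1\<close> is the only count below \<open>m\<close> that survives in the limit.
\<close>

lemma small_count_limit:
  assumes "j < m"
  shows "(\<lambda>i. n i * poisson_weight (lam i) j) \<longlonglongrightarrow> (if j = m - 1 then exp (- x) / fact (m - 1) else 0)"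
proof -
  have "(\<lambda>i. (lam i / L i) ^ j * exp (- theta i) * (1 / L i) ^ (m - 1 - j) / fact j)
      \<longlonglongrightarrow> 1 ^ j * exp (- x) * 0 ^ (m - 1 - j) / fact j"
    by (intro tendsto_divide tendsto_mult tendsto_power lam_over_L tendsto_exp tendsto_minus theta_limit n_limits tendsto_const) simp
  moreover have "\<forall>\<^sub>F i in sequentially. (lam i / L i) ^ j * exp (- theta i) * (1 / L i) ^ (m - 1 - j) / fact j = n i * poisson_weight (lam i) j"
    using large n_exp_lam
  proof eventually_elim
    case (elim i)
    have "exp (l i) = L i" using elim by (simp add: l_def)
    moreover have "exp (- ((real m - 1) * l i)) = exp (- l i) ^ (m - 1)"
      using m_ge_1 by (simp add: exp_of_nat_mult[symmetric] of_nat_diff)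
    ultimately have "exp (- ((real m - 1) * l i)) = (1 / L i) ^ (m - 1)"
      by (simp add: exp_minus inverse_eq_divide)
    also have "m - 1 = j + (m - 1 - j)" using assms by simp
    finally have "exp (- ((real m - 1) * l i)) = (1 / L i) ^ j * (1 / L i) ^ (m - 1 - j)"
      by (simp only: power_add)
    moreover have "n i * poisson_weight (lam i) j = lam i ^ j / fact j * (n i * exp (- lam i))"
      by (simp add: poisson_weight_def)
    ultimately show ?case
      using elim(2) by (simp add: power_divide)
  qed
  moreover have "1 ^ j * exp (- x) * 0 ^ (m - 1 - j) / fact j = (if j = m - 1 then exp (- x) / fact (m - 1) else 0)"
    using assms by (auto simp: power_0_left)
  ultimately show ?thesis
    by (simp add: Lim_transform_eventually)
qed

lemma mu_limit1: "(\<lambda>i. n i * poisson_weight (t i / n i) (m - 1)) \<longlonglongrightarrow> exp (- x) / fact (m - 1)"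
  using small_count_limit[of "m - 1"] m_ge_1 unfolding lam_def by simp

lemma mu_limit2: "(\<lambda>i. n i * (\<Sum>j<m. poisson_weight (t i / n i) j)) \<longlonglongrightarrow> exp (- x) / fact (m - 1)"
proof -
  have "(\<lambda>i. \<Sum>j<m. n i * poisson_weight (lam i) j) \<longlonglongrightarrow> (\<Sum>j<m. if j = m - 1 then exp (- x) / fact (m - 1) else 0)"
    by (intro tendsto_sum small_count_limit) simp
  moreover have "(\<Sum>j<m. if j = m - 1 then exp (- x) / fact (m - 1) else 0) = exp (- x) / fact (m - 1)"
    using m_ge_1 by simp
  ultimately show ?thesis
    by (simp add: sum_distrib_left lam_def)
qed

text \<open>
  By Stirling's formula \<open>lam^k / k!\<close> contains the factor \<open>(e lam / k)^k\<close>, which is approximately \<open>exp gap\<close>. The gap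
  is at most of order \<open>log log n\<close>, so its square is negligible against \<open>k\<close>.
\<close>

definition gap where "gap i = exp 1 * lam i - k i"

lemma gap_eq: "gap i = (real m - 1/2) * l i + exp 1 * theta i - \<delta> i"
  unfolding gap_def theta_def k_eq L_def[symmetric] l_def[symmetric] by (simp add: algebra_simps)

lemma gap2_over_k: "(\<lambda>i. (gap i)\<^sup>2 / k i) \<longlonglongrightarrow> 0"
proof -
  have dl: "(\<lambda>i. \<delta> i / l i) \<longlonglongrightarrow> 0"
    using delta_small by (simp add: l_def L_def)
  have "(\<lambda>i. ((real m - 1/2) + exp 1 * theta i * (1 / l i) - \<delta> i / l i)\<^sup>2 * ((l i)\<^sup>2 / L i) / (k i / L i))
      \<longlonglongrightarrow> ((real m - 1/2) + exp 1 * x * 0 - 0)\<^sup>2 * 0 / exp 1"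
    by (intro tendsto_intros theta_limit dl n_limits k_over_L) simp
  moreover have "\<forall>\<^sub>F i in sequentially. ((real m - 1/2) + exp 1 * theta i * (1 / l i) - \<delta> i / l i)\<^sup>2 * ((l i)\<^sup>2 / L i) / (k i / L i) = (gap i)\<^sup>2 / k i"
    using large
  proof eventually_elim
    case (elim i)
    have "gap i = ((real m - 1/2) + exp 1 * theta i * (1 / l i) - \<delta> i / l i) * l i"
      unfolding gap_eq using elim by (simp add: field_simps)
    then show ?case using elim by (simp add: power_mult_distrib)
  qed
  ultimately show ?thesis by (simp add: Lim_transform_eventually)
qed

text \<open>
  With \<open>1 + u = e lam / k\<close> one has \<open>gap = k u\<close>, and \<open>k (log (1 + u) - u)\<close> is at most \<open>2 k u\<^sup>2 = 2 gap\<^sup>2 / k\<close>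
  in absolute value.
\<close>

lemma log_correction: "(\<lambda>i. k i * ln (exp 1 * lam i / k i) - gap i) \<longlonglongrightarrow> 0"
proof (rule Lim_null_comparison)
  have kpos: "\<forall>\<^sub>F i in sequentially. k i > 0"
    by (rule eventually_compose_filterlim[OF eventually_gt_at_top k_lim])
  have "(\<lambda>i. exp 1 * (lam i / L i) / (k i / L i) - 1) \<longlonglongrightarrow> exp 1 * 1 / exp 1 - 1"
    by (intro tendsto_intros lam_over_L k_over_L) simp
  from tendsto_rabs[OF this]
  have "\<forall>\<^sub>F i in sequentially. \<bar>exp 1 * (lam i / L i) / (k i / L i) - 1\<bar> < 1/2"
    by (rule order_tendstoD(2)) simp
  then show "\<forall>\<^sub>F i in sequentially. norm (k i * ln (exp 1 * lam i / k i) - gap i) \<le> 2 * ((gap i)\<^sup>2 / k i)"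
    using large kpos
  proof eventually_elim
    case (elim i)
    define u where "u = exp 1 * lam i / k i - 1"
    have u: "\<bar>u\<bar> \<le> 1/2" using elim by (simp add: u_def)
    have gu: "gap i = k i * u" using elim by (simp add: gap_def u_def field_simps)
    have "k i * ln (exp 1 * lam i / k i) - gap i = k i * (ln (1 + u) - u)"
      unfolding gu by (simp add: u_def algebra_simps)
    then have "norm (k i * ln (exp 1 * lam i / k i) - gap i) = k i * \<bar>ln (1 + u) - u\<bar>"
      by (simp add: abs_mult)
    also have "\<dots> \<le> k i * (2 * u\<^sup>2)"
      by (intro mult_left_mono abs_ln_one_plus_x_minus_x_bound u) simp
    also have "\<dots> = 2 * ((gap i)\<^sup>2 / k i)"
      using elim unfolding gu by (simp add: power_mult_distrib power2_eq_square)
    finally show ?case .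
  qed
  show "(\<lambda>i. 2 * ((gap i)\<^sup>2 / k i)) \<longlonglongrightarrow> 0"
    by (rule tendsto_mult_right_zero[OF gap2_over_k])
qed

text \<open>
  By Stirling's formula the mean is asymptotically \<open>n exp (-lam) (e lam / k)^k / sqrt (2 \<pi> k)\<close>. The three factors
  contribute \<open>exp (-theta - (m - 1) l)\<close>, \<open>exp ((m - 1/2) l + e theta - \<delta>)\<close> and \<open>exp (-l/2) / sqrt (2 \<pi> e)\<close>,
  in which all powers of \<open>log n\<close> cancel; this determines the coefficient of \<open>log log n\<close> in \<open>k\<close>.
\<close>

lemma mean_tons_asymptotics:
  "(\<lambda>i. n i * poisson_weight (t i / n i) (k i) * exp (\<delta> i)) \<longlonglongrightarrow> exp ((exp 1 - 1) * x) / sqrt (2 * pi * exp 1)"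
proof -
  define S where "S j = fact j / (sqrt (2 * pi * j) * (real j / exp 1) ^ j)" for j
  define cor where "cor i = k i * ln (exp 1 * lam i / k i) - gap i" for i
  have S: "(\<lambda>i. S (k i)) \<longlonglongrightarrow> 1"
    unfolding S_def by (rule filterlim_compose[OF stirling k_lim])
  have cor: "cor \<longlonglongrightarrow> 0" unfolding cor_def[abs_def] by (rule log_correction)
  have kpos: "\<forall>\<^sub>F i in sequentially. k i > 0"
    by (rule eventually_compose_filterlim[OF eventually_gt_at_top k_lim])
  have "(\<lambda>i. exp ((exp 1 - 1) * theta i + cor i) / (S (k i) * (sqrt (2 * pi) * sqrt (k i / L i))))
     \<longlonglongrightarrow> exp ((exp 1 - 1) * x + 0) / (1 * (sqrt (2 * pi) * sqrt (exp 1)))"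
    by (intro tendsto_divide tendsto_exp tendsto_add tendsto_mult tendsto_const theta_limit cor S tendsto_real_sqrt k_over_L) simp
  moreover have "\<forall>\<^sub>F i in sequentially. exp ((exp 1 - 1) * theta i + cor i) / (S (k i) * (sqrt (2 * pi) * sqrt (k i / L i))) =
     n i * poisson_weight (t i / n i) (k i) * exp (\<delta> i)"
    using large kpos lam_pos n_exp_lam
  proof eventually_elim
    case (elim i)
    have fact: "fact (k i) = S (k i) * (sqrt (2 * pi * k i) * (real (k i) / exp 1) ^ k i)"
      using elim by (simp add: S_def)
    have sq: "sqrt (2 * pi * k i) = sqrt (2 * pi) * sqrt (k i / L i) * exp (l i / 2)"
    proof -
      have "exp (l i / 2) = sqrt (L i)"
        using elim by (intro real_sqrt_unique[symmetric]) (auto simp: power2_eq_square mult_exp_exp l_def)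
      then show ?thesis using elim by (simp add: real_sqrt_mult real_sqrt_divide)
    qed
    have "(exp 1 * lam i / k i) ^ k i = exp (k i * ln (exp 1 * lam i / k i))"
      using elim by (subst exp_of_nat_mult) simp
    then have pow: "(exp 1 * lam i / k i) ^ k i = exp (gap i + cor i)"
      by (simp add: cor_def)
    have "n i * poisson_weight (t i / n i) (k i) * exp (\<delta> i) = (n i * exp (- lam i)) * (lam i ^ k i / fact (k i)) * exp (\<delta> i)"
      by (simp add: poisson_weight_def lam_def)
    also have "lam i ^ k i / fact (k i) = (exp 1 * lam i / k i) ^ k i / (S (k i) * sqrt (2 * pi * k i))"
      unfolding fact using elim by (simp add: power_divide power_mult_distrib mult_ac)
    also have "(n i * exp (- lam i)) * ((exp 1 * lam i / k i) ^ k i / (S (k i) * sqrt (2 * pi * k i))) * exp (\<delta> i) =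
       (exp (- theta i) * exp (- ((real m - 1) * l i)) * exp (gap i + cor i) * exp (\<delta> i) * exp (- (l i / 2))) /
         (S (k i) * (sqrt (2 * pi) * sqrt (k i / L i)))"
      unfolding pow sq elim(4) by (simp add: exp_minus field_simps)
    also have "exp (- theta i) * exp (- ((real m - 1) * l i)) * exp (gap i + cor i) * exp (\<delta> i) * exp (- (l i / 2)) = exp ((exp 1 - 1) * theta i + cor i)"
      unfolding mult_exp_exp gap_eq by (simp add: algebra_simps)
    finally show ?case by simp
  qed
  ultimately have "(\<lambda>i. n i * poisson_weight (t i / n i) (k i) * exp (\<delta> i)) \<longlonglongrightarrow> exp ((exp 1 - 1) * x + 0) / (1 * (sqrt (2 * pi) * sqrt (exp 1)))"
    by (rule Lim_transform_eventually)
  then show ?thesis by (simp add: real_sqrt_mult)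
qed

end

section \<open>From local to global limits\<close>

lemma liminf_ennreal_ge:
  assumes "f \<longlonglongrightarrow> L" "\<forall>\<^sub>F i in sequentially. f i \<le> g i"
  shows "ennreal L \<le> liminf (\<lambda>i. ennreal (g i))"
proof -
  have "ennreal L = liminf (\<lambda>i. ennreal (f i))"
    by (intro lim_imp_Liminf[symmetric] tendsto_ennrealI assms) simp
  also have "\<dots> \<le> liminf (\<lambda>i. ennreal (g i))"
    using assms(2) by (intro Liminf_mono) (auto elim: eventually_mono intro: ennreal_leI)
  finally show ?thesis .
qed

lemma eventually_gt_of_liminf:
  assumes "ennreal A \<le> liminf (\<lambda>i. ennreal (a i))" "\<And>i. a i \<ge> 0" "y < A"
  shows "\<forall>\<^sub>F i in sequentially. y < a i"
proof (cases "y < 0")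
  case True
  then show ?thesis using assms(2) by (intro always_eventually allI) (meson less_le_trans)
next
  case False
  then have "ennreal y < ennreal A" using assms(3) by (simp add: ennreal_less_iff)
  then have "\<forall>\<^sub>F i in sequentially. ennreal y < ennreal (a i)"
    using assms(1) by (simp add: le_Liminf_iff)
  then show ?thesis using False by (simp add: ennreal_less_iff)
qed

text \<open>
  A sum over \<open>t\<close> is the integral over \<open>x\<close> of a step function whose steps have length \<open>1/n\<close>, the step of \<open>t\<close>
  beginning at \<open>x = t/n - a\<close>. The claim is Fatou's lemma for these step functions.
\<close>

lemma fatou_local_to_global:
  fixes w :: "nat \<Rightarrow> nat \<Rightarrow> ennreal" and n :: "nat \<Rightarrow> nat" and a :: "nat \<Rightarrow> real" and h :: "real \<Rightarrow> ennreal"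
  assumes n: "\<And>i. n i > 0" and a: "filterlim a at_top sequentially"
    and local: "\<And>x. h x \<le> liminf (\<lambda>i. ennreal (n i) * w i (nat \<lfloor>n i * (a i + x)\<rfloor>))"
  shows "(\<integral>\<^sup>+x. h x \<partial>lborel) \<le> liminf (\<lambda>i. \<Sum>t. w i t)"
proof -
  define I where "I i t = {real t / n i - a i ..< (real t + 1) / n i - a i}" for i t
  define H where "H i x = (\<Sum>t. ennreal (n i) * w i t * indicator (I i t) x)" for i x
  have meas [measurable]: "I i t \<in> sets borel" for i t
    by (simp add: I_def)
  have H [measurable]: "H i \<in> borel_measurable lborel" for i
    unfolding H_def by measurable
  have int: "(\<integral>\<^sup>+x. H i x \<partial>lborel) = (\<Sum>t. w i t)" for i
  proof -
    have inner: "(\<integral>\<^sup>+x. ennreal (n i) * w i t * indicator (I i t) x \<partial>lborel) = w i t" for t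
    proof -
      have "(\<integral>\<^sup>+x. ennreal (n i) * w i t * indicator (I i t) x \<partial>lborel) = ennreal (n i) * w i t * emeasure lborel (I i t)"
        by (intro nn_integral_cmult_indicator) simp
      also have "emeasure lborel (I i t) = ennreal (1 / n i)"
        using n[of i] unfolding I_def by (subst emeasure_lborel_Ico) (auto simp: field_simps)
      also have "ennreal (n i) * w i t * ennreal (1 / n i) = w i t * ennreal (n i * (1 / n i))"
        by (subst ennreal_mult) (simp_all add: mult_ac)
      finally show ?thesis using n[of i] by simp
    qed
    have "(\<integral>\<^sup>+x. H i x \<partial>lborel) = (\<Sum>t. \<integral>\<^sup>+x. ennreal (n i) * w i t * indicator (I i t) x \<partial>lborel)"
      unfolding H_def by (intro nn_integral_suminf) measurable
    then show ?thesis by (simp only: inner)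
  qed
  have "h x \<le> liminf (\<lambda>i. H i x)" for x
  proof -
    have "\<forall>\<^sub>F i in sequentially. - x \<le> a i"
      using a by (simp add: filterlim_at_top)
    then have "\<forall>\<^sub>F i in sequentially. ennreal (n i) * w i (nat \<lfloor>n i * (a i + x)\<rfloor>) \<le> H i x"
    proof eventually_elim
      case (elim i)
      define t where "t = nat \<lfloor>n i * (a i + x)\<rfloor>"
      have "0 \<le> n i * (a i + x)" using elim by simp
      then have "real t \<le> n i * (a i + x)" "n i * (a i + x) < real t + 1"
        unfolding t_def by linarith+
      then have "x \<in> I i t"
        using n[of i] by (auto simp: I_def field_simps)
      then have "ennreal (n i) * w i t = (\<Sum>s\<in>{t}. ennreal (n i) * w i s * indicator (I i s) x)"
        by simp
      also have "\<dots> \<le> H i x"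
        unfolding H_def by (intro sum_le_suminf) auto
      finally show ?case by (simp add: t_def)
    qed
    then have "liminf (\<lambda>i. ennreal (n i) * w i (nat \<lfloor>n i * (a i + x)\<rfloor>)) \<le> liminf (\<lambda>i. H i x)"
      by (rule Liminf_mono)
    then show ?thesis using local order_trans by blast
  qed
  then have "(\<integral>\<^sup>+x. h x \<partial>lborel) \<le> (\<integral>\<^sup>+x. liminf (\<lambda>i. H i x) \<partial>lborel)"
    by (intro nn_integral_mono)
  also have "\<dots> \<le> liminf (\<lambda>i. \<integral>\<^sup>+x. H i x \<partial>lborel)"
    by (intro nn_integral_liminf) measurable
  finally show ?thesis unfolding int .
qed

text \<open>
  For \<open>\<bar>f\<bar> \<le> B\<close> the hypothesis applies to \<open>B + f\<close> and to \<open>B - f\<close>; as all measures have mass 1, this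
  bounds the integrals of \<open>f\<close> from both sides.
\<close>

lemma weakly_convergesI_liminf:
  fixes \<mu> :: "nat \<Rightarrow> 'a::topological_space measure"
  assumes \<mu>: "\<And>i. prob_space (\<mu> i)" "\<And>i. sets (\<mu> i) = sets borel"
    and \<nu>: "prob_space \<nu>" "sets \<nu> = sets borel"
    and liminf: "\<And>f :: 'a \<Rightarrow> real. continuous_on UNIV f \<Longrightarrow> (\<And>x. f x \<ge> 0) \<Longrightarrow>
       (\<integral>\<^sup>+x. ennreal (f x) \<partial>\<nu>) \<le> liminf (\<lambda>i. \<integral>\<^sup>+x. ennreal (f x) \<partial>\<mu> i)"
  shows "weakly_converges \<mu> \<nu>"
  unfolding weakly_converges_def
proof (intro allI impI)
  fix f :: "'a \<Rightarrow> real" assume cont: "continuous_on UNIV f" and "bounded (range f)"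
  then obtain B where B: "\<And>x. \<bar>f x\<bar> \<le> B" by (auto simp: bounded_iff)
  have meas: "f \<in> borel_measurable borel"
    using cont by (rule borel_measurable_continuous_onI)
  have int: "integrable \<kappa> f" if "prob_space \<kappa>" "sets \<kappa> = sets borel" for \<kappa> :: "'a measure"
  proof -
    interpret prob_space \<kappa> by fact
    show ?thesis
      by (rule integrable_const_bound[where B = B]) (use B meas that in \<open>auto cong: measurable_cong_sets\<close>)
  qed
  have nn: "(\<integral>\<^sup>+x. ennreal (c * f x + B) \<partial>\<kappa>) = ennreal (c * integral\<^sup>L \<kappa> f + B)" "0 \<le> c * integral\<^sup>L \<kappa> f + B"
    if "prob_space \<kappa>" "sets \<kappa> = sets borel" "\<bar>c\<bar> = 1" for \<kappa> :: "'a measure" and c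
  proof -
    interpret prob_space \<kappa> by fact
    have pos: "0 \<le> c * f x + B" for x using B[of x] that(3) by (auto simp: abs_if split: if_splits)
    have eq: "(\<integral>x. c * f x + B \<partial>\<kappa>) = c * integral\<^sup>L \<kappa> f + B"
      using int[OF that(1,2)] by (simp add: prob_space)
    show "(\<integral>\<^sup>+x. ennreal (c * f x + B) \<partial>\<kappa>) = ennreal (c * integral\<^sup>L \<kappa> f + B)"
      unfolding eq[symmetric] using int[OF that(1,2)] pos by (intro nn_integral_eq_integral) auto
    show "0 \<le> c * integral\<^sup>L \<kappa> f + B"
      unfolding eq[symmetric] using pos by (intro integral_nonneg_AE) auto
  qed
  \<comment> \<open>The cases \<open>c = 1\<close> and \<open>c = -1\<close> give the bounds from below and from above.\<close>
  have lower: "\<forall>\<^sub>F i in sequentially. y < c * integral\<^sup>L (\<mu> i) f + B" if "y < c * integral\<^sup>L \<nu> f + B" "\<bar>c\<bar> = 1" for y c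
  proof (rule eventually_gt_of_liminf[OF _ _ that(1)])
    have "(\<integral>\<^sup>+x. ennreal (c * f x + B) \<partial>\<nu>) \<le> liminf (\<lambda>i. \<integral>\<^sup>+x. ennreal (c * f x + B) \<partial>\<mu> i)"
    proof (rule liminf)
      show "continuous_on UNIV (\<lambda>x. c * f x + B)" using cont by (intro continuous_intros)
      show "0 \<le> c * f x + B" for x using B[of x] that(2) by (auto simp: abs_if split: if_splits)
    qed
    then show "ennreal (c * integral\<^sup>L \<nu> f + B) \<le> liminf (\<lambda>i. ennreal (c * integral\<^sup>L (\<mu> i) f + B))"
      using that(2) by (simp only: nn(1)[OF \<mu> that(2)] nn(1)[OF \<nu> that(2)])
    show "0 \<le> c * integral\<^sup>L (\<mu> i) f + B" for i by (rule nn(2)[OF \<mu> that(2)])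
  qed
  show "(\<lambda>i. integral\<^sup>L (\<mu> i) f) \<longlonglongrightarrow> integral\<^sup>L \<nu> f"
  proof (rule order_tendstoI)
    fix y assume "y < integral\<^sup>L \<nu> f"
    then show "\<forall>\<^sub>F i in sequentially. y < integral\<^sup>L (\<mu> i) f"
      using lower[of "y + B" 1] by simp
  next
    fix y assume "integral\<^sup>L \<nu> f < y"
    then show "\<forall>\<^sub>F i in sequentially. integral\<^sup>L (\<mu> i) f < y"
      using lower[of "- y + B" "- 1"] by simp
  qed
qed

section \<open>The Gumbel law and its Poisson mixture\<close>

text \<open>
  The density of the Gumbel law with location \<open>- log c\<close> and scale 1, the form in which it arises with
  \<open>c = (m - 1)!\<close>.
\<close>

definition gumbel_density :: "real \<Rightarrow> real \<Rightarrow> real" where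
  "gumbel_density c x = exp (- x) / c * exp (- (exp (- x) / c))"

lemma gumbel_density_measurable [measurable]: "gumbel_density c \<in> borel_measurable borel"
  unfolding gumbel_density_def[abs_def] by measurable

lemma gumbel_eq_density:
  assumes c: "c > 0"
  shows "gumbel (- ln c) 1 = density lborel (\<lambda>x. ennreal (gumbel_density c x))"
proof -
  let ?D = "density lborel (\<lambda>x. ennreal (gumbel_density c x))"
  interpret G: real_distribution "gumbel (- ln c) 1"
    by (rule real_distribution_gumbel) simp
  define F where "F x = exp (- (exp (- x) / c))" for x
  have cdf: "cdf (gumbel (- ln c) 1) x = F x" for x
    using c by (simp add: cdf_gumbel F_def exp_diff)
  have deriv: "(F has_real_derivative gumbel_density c x) (at x)" for x
    using c unfolding F_def gumbel_density_def by (auto intro!: derivative_eq_intros)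
  have Ioc: "emeasure ?D {a<..b} = emeasure (gumbel (- ln c) 1) {a<..b}" if "a \<le> b" for a b
  proof -
    have "emeasure ?D {a<..b} = (\<integral>\<^sup>+x. ennreal (gumbel_density c x) * indicator {a<..b} x \<partial>lborel)"
      by (rule emeasure_density) auto
    also have "\<dots> = (\<integral>\<^sup>+x. ennreal (gumbel_density c x) * indicator {a..b} x \<partial>lborel)"
      by (intro nn_integral_cong_AE, use AE_lborel_singleton[of a] in eventually_elim) (auto simp: indicator_def)
    also have "\<dots> = ennreal (F b - F a)"
      by (rule nn_integral_FTC_Icc) (use that c deriv in \<open>auto simp: gumbel_density_def has_vector_derivative_at_within
           has_real_derivative_iff_has_vector_derivative[symmetric] has_field_derivative_at_within\<close>)
    finally show ?thesis
      using that by (simp add: G.emeasure_Ioc cdf)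
  qed
  show ?thesis
  proof (rule measure_eqI_generator_eq[where \<Omega> = UNIV and E = "range (\<lambda>(a, b). {a<..b::real})" and A = "\<lambda>i. {- real i<..real i}"])
    fix S assume "S \<in> range (\<lambda>(a, b). {a<..b::real})"
    then obtain a b where S: "S = {a<..b}" by auto
    show "emeasure (gumbel (- ln c) 1) S = emeasure ?D S"
      unfolding S by (cases "a \<le> b") (simp_all add: Ioc)
  next
    show "(\<Union>i. {- real i<..real i}) = UNIV"
      by (rule UN_Ioc_eq_UNIV)
  next
    show "Int_stable (range (\<lambda>(a, b). {a<..b::real}))"
      by (auto simp: Int_stable_def)
  qed (auto simp: borel_sigma_sets_Ioc)
qed

lemma nn_integral_mixed_poisson:
  fixes f :: "real \<times> real \<Rightarrow> ennreal"
  assumes \<mu>: "real_distribution \<mu>" and r: "r \<in> borel_measurable borel" "\<And>x. r x > 0"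
    and f [measurable]: "f \<in> borel_measurable borel"
  shows "(\<integral>\<^sup>+z. f z \<partial>mixed_poisson \<mu> r) = (\<integral>\<^sup>+x. (\<Sum>s. ennreal (r x ^ s / fact s * exp (- r x)) * f (x, real s)) \<partial>\<mu>)"
proof -
  interpret real_distribution \<mu> by fact
  have "(\<integral>\<^sup>+z. f z \<partial>mixed_poisson \<mu> r) =
      (\<integral>\<^sup>+x. \<integral>\<^sup>+z. f z \<partial>distr (measure_pmf (poisson_pmf (r x))) borel (\<lambda>y. (x, real y)) \<partial>\<mu>)"
    unfolding mixed_poisson_def
    by (rule nn_integral_bind[OF f]) (use mixed_poisson_kernel[OF r] in \<open>auto cong: measurable_cong_sets\<close>)
  also have "\<dots> = (\<integral>\<^sup>+x. (\<Sum>s. ennreal (r x ^ s / fact s * exp (- r x)) * f (x, real s)) \<partial>\<mu>)"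
    by (intro nn_integral_cong) (subst nn_integral_distr; simp add: nn_integral_measure_pmf nn_integral_count_space_nat r(2))
  finally show ?thesis .
qed

lemma prob_space_mixed_poisson:
  assumes \<mu>: "real_distribution \<mu>" and r: "r \<in> borel_measurable borel" "\<And>x. r x > 0"
  shows "prob_space (mixed_poisson \<mu> r)" "sets (mixed_poisson \<mu> r) = sets borel"
proof -
  interpret real_distribution \<mu> by fact
  have kernel: "(\<lambda>x. distr (measure_pmf (poisson_pmf (r x))) borel (\<lambda>y. (x, real y))) \<in> \<mu> \<rightarrow>\<^sub>M subprob_algebra borel"
    using mixed_poisson_kernel[OF r] by (auto cong: measurable_cong_sets)
  show "sets (mixed_poisson \<mu> r) = sets borel"
    unfolding mixed_poisson_def by (rule sets_bind[OF sets_kernel[OF kernel]]) auto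
  show "prob_space (mixed_poisson \<mu> r)"
    unfolding mixed_poisson_def
    by (rule prob_space_bind[OF _ kernel]) (auto intro!: AE_I2 prob_space.prob_space_distr prob_space_measure_pmf)
qed

section \<open>Disintegration by the completing draw\<close>

context coupon
begin

text \<open>
  The events that draw \<open>t\<close> completes the collection are disjoint, since each of them determines the stopping time.
\<close>

lemma sum_completes_le:
  assumes m: "m \<ge> 1" and F [measurable]: "F \<in> borel_measurable M"
  shows "(\<Sum>t. \<integral>\<^sup>+\<omega>. F \<omega> * indicator {\<omega>\<in>space M. completes m t \<omega>} \<omega> \<partial>M) \<le> (\<integral>\<^sup>+\<omega>. F \<omega> \<partial>M)"
proof -
  have "(\<Sum>t. \<integral>\<^sup>+\<omega>. F \<omega> * indicator {\<omega>\<in>space M. completes m t \<omega>} \<omega> \<partial>M) =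
      (\<integral>\<^sup>+\<omega>. (\<Sum>t. F \<omega> * indicator {\<omega>\<in>space M. completes m t \<omega>} \<omega>) \<partial>M)"
    by (intro nn_integral_suminf[symmetric]) measurable
  also have "\<dots> \<le> (\<integral>\<^sup>+\<omega>. F \<omega> \<partial>M)"
  proof (intro nn_integral_mono)
    fix \<omega>
    have singleton: "(\<Sum>t\<in>{u}. g t) = g u" for g :: "nat \<Rightarrow> ennreal" and u
      by simp
    \<comment> \<open>The only index that can contribute, as draws are counted from 0.\<close>
    let ?u = "stop_time m n X \<omega> - 1"
    have "(\<Sum>t. F \<omega> * indicator {\<omega>\<in>space M. completes m t \<omega>} \<omega>) =
        (\<Sum>t\<in>{?u}. F \<omega> * indicator {\<omega>\<in>space M. completes m t \<omega>} \<omega>)"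
      by (intro suminf_finite) (auto simp: indicator_def stop_time_completes[OF m])
    also have "\<dots> = F \<omega> * indicator {\<omega>\<in>space M. completes m ?u \<omega>} \<omega>"
      by (rule singleton)
    also have "\<dots> \<le> F \<omega>"
      by (simp add: indicator_def)
    finally show "(\<Sum>t. F \<omega> * indicator {\<omega>\<in>space M. completes m t \<omega>} \<omega>) \<le> F \<omega>" .
  qed
  finally show ?thesis .
qed

lemma nn_integral_completes_num_tons:
  "(\<integral>\<^sup>+\<omega>. f (num_tons m n X k \<omega>) * indicator {\<omega>\<in>space M. completes m t \<omega>} \<omega> \<partial>M) =
    (\<Sum>s. f s * ennreal \<P>(\<omega> in M. completes m t \<omega> \<and> num_tons m n X k \<omega> = s))"
proof -
  have "(\<integral>\<^sup>+\<omega>. f (num_tons m n X k \<omega>) * indicator {\<omega>\<in>space M. completes m t \<omega>} \<omega> \<partial>M) =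
     (\<integral>\<^sup>+\<omega>. (\<Sum>s. f s * indicator {\<omega>\<in>space M. completes m t \<omega> \<and> num_tons m n X k \<omega> = s} \<omega>) \<partial>M)"
  proof (intro nn_integral_cong)
    fix \<omega>
    have "(\<Sum>s. f s * indicator {\<omega>\<in>space M. completes m t \<omega> \<and> num_tons m n X k \<omega> = s} \<omega>) =
      (\<Sum>s\<in>{num_tons m n X k \<omega>}. f s * indicator {\<omega>\<in>space M. completes m t \<omega> \<and> num_tons m n X k \<omega> = s} \<omega>)"
      by (intro suminf_finite) (auto simp: indicator_def)
    then show "f (num_tons m n X k \<omega>) * indicator {\<omega>\<in>space M. completes m t \<omega>} \<omega> =
      (\<Sum>s. f s * indicator {\<omega>\<in>space M. completes m t \<omega> \<and> num_tons m n X k \<omega> = s} \<omega>)"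
      by (simp add: indicator_def)
  qed
  also have "\<dots> = (\<Sum>s. \<integral>\<^sup>+\<omega>. f s * indicator {\<omega>\<in>space M. completes m t \<omega> \<and> num_tons m n X k \<omega> = s} \<omega> \<partial>M)"
    by (intro nn_integral_suminf) measurable
  also have "\<dots> = (\<Sum>s. f s * ennreal \<P>(\<omega> in M. completes m t \<omega> \<and> num_tons m n X k \<omega> = s))"
    by (intro suminf_cong) (subst nn_integral_cmult_indicator; simp add: emeasure_eq_measure)
  finally show ?thesis .
qed

end

section \<open>The limit laws\<close>

lemma coupon_process_imp_coupon:
  assumes "coupon_process M n X" "n \<ge> 2"
  shows "coupon M n X"
proof -
  interpret prob_space M using assms by (simp add: coupon_process_def)
  show ?thesis
    by unfold_locales (use assms in \<open>auto simp: coupon_process_def\<close>)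
qed

text \<open>
  One coupon process for every index, with a number \<open>k i\<close> that differs by \<open>\<delta> i = o(log log n)\<close> from the threshold at
  which \<open>k\<close>-tons appear at the end of the collection.
\<close>

locale critical_coupons =
  fixes M :: "nat \<Rightarrow> 'a measure" and n :: "nat \<Rightarrow> nat" and X :: "nat \<Rightarrow> nat \<Rightarrow> 'a \<Rightarrow> nat"
    and m :: nat and k :: "nat \<Rightarrow> nat" and \<delta> :: "nat \<Rightarrow> real"
  assumes coupon: "coupon (M i) (n i) (X i)"
    and m_ge_1: "m \<ge> 1"
    and n_lim: "filterlim n at_top sequentially"
    and k_eq: "real (k i) = exp 1 * ln (n i) + ((exp 1 - 1) * (real m - 1) - 1 / 2) * ln (ln (n i)) + \<delta> i"
    and delta_small: "(\<lambda>i. \<delta> i / ln (ln (n i))) \<longlonglongrightarrow> 0"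
begin

definition centre :: "nat \<Rightarrow> real" where
  "centre i = ln (n i) + (real m - 1) * ln (ln (n i))"

text \<open>
  An integer time at position \<open>x\<close> in the critical window. For every \<open>x\<close>, the truncation of negative
  values affects finitely many \<open>i\<close> only.
\<close>

definition draws :: "real \<Rightarrow> nat \<Rightarrow> nat" where
  "draws x i = nat \<lfloor>n i * (centre i + x)\<rfloor>"

lemma n_pos: "n i > 0"
  by (rule coupon.n_pos[OF coupon])

lemma centre_lim: "filterlim centre at_top sequentially"
  unfolding centre_def[abs_def]
proof (rule filterlim_compose[OF _ n_lim])
  show "filterlim (\<lambda>n. ln (real n) + (real m - 1) * ln (ln (real n))) at_top sequentially"
  proof (rule filterlim_at_top_mono)
    show "filterlim (\<lambda>n. ln (real n)) at_top sequentially" by real_asymp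
    have "\<forall>\<^sub>F n in sequentially. 0 \<le> ln (ln (real n))" by real_asymp
    then show "\<forall>\<^sub>F n in sequentially. ln (real n) \<le> ln (real n) + (real m - 1) * ln (ln (real n))"
      by eventually_elim (use m_ge_1 in simp)
  qed
qed

lemma draws_lim: "(\<lambda>i. real (draws x i) / n i - centre i) \<longlonglongrightarrow> x"
proof (rule tendsto_sandwich)
  have "\<forall>\<^sub>F i in sequentially. - x \<le> centre i"
    using centre_lim by (simp add: filterlim_at_top)
  then have ev: "\<forall>\<^sub>F i in sequentially. x - 1 / n i \<le> real (draws x i) / n i - centre i \<and> real (draws x i) / n i - centre i \<le> x"
  proof eventually_elim
    case (elim i)
    have "0 \<le> n i * (centre i + x)" using elim by simp
    then have "real (draws x i) \<le> n i * (centre i + x)" "n i * (centre i + x) - 1 \<le> real (draws x i)"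
      unfolding draws_def by linarith+
    then have "real (draws x i) / n i \<le> n i * (centre i + x) / n i" "(n i * (centre i + x) - 1) / n i \<le> real (draws x i) / n i"
      by (intro divide_right_mono; simp)+
    then show ?case using n_pos[of i] by (simp add: diff_divide_distrib)
  qed
  then show "\<forall>\<^sub>F i in sequentially. x - 1 / n i \<le> real (draws x i) / n i - centre i"
    by (rule eventually_mono) simp
  from ev show "\<forall>\<^sub>F i in sequentially. real (draws x i) / n i - centre i \<le> x"
    by (rule eventually_mono) simp
  show "(\<lambda>i. x - 1 / n i) \<longlonglongrightarrow> x"
    by (rule filterlim_compose[OF _ n_lim]) real_asymp
qed simp

lemma window: "critical_window n (draws x) k m \<delta> x"
proof
  show "(\<lambda>i. real (draws x i) / n i - ln (n i) - (real m - 1) * ln (ln (n i))) \<longlonglongrightarrow> x"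
    using draws_lim[of x] by (simp only: centre_def diff_diff_eq)
qed (rule m_ge_1 n_lim k_eq delta_small)+

sublocale coupon_sequence M n X m k
  by (rule coupon_sequence.intro) (rule coupon m_ge_1 n_lim critical_window.k_lim[OF window])+

definition mu :: "real \<Rightarrow> real" where "mu x = exp (- x) / fact (m - 1)"

lemmas window_conditions =
  critical_window.t_pos[OF window] critical_window.k2_over_t[OF window] critical_window.k_over_n[OF window]
  critical_window.t_over_n2[OF window] critical_window.mu_limit1[OF window, folded mu_def]
  critical_window.mu_limit2[OF window, folded mu_def]

lemma mean_tons_asymptotics:
  "(\<lambda>i. mean_tons i (draws x i) * exp (\<delta> i)) \<longlonglongrightarrow> exp ((exp 1 - 1) * x) / sqrt (2 * pi * exp 1)"
  using critical_window.mean_tons_asymptotics[OF window] by (simp add: mean_tons_def)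

lemma mean_tons_limit:
  assumes "(\<lambda>i. exp (- \<delta> i)) \<longlonglongrightarrow> c"
  shows "(\<lambda>i. mean_tons i (draws x i)) \<longlonglongrightarrow> exp ((exp 1 - 1) * x) / sqrt (2 * pi * exp 1) * c"
  using tendsto_mult[OF mean_tons_asymptotics[of x] assms]
  by (simp add: mult.assoc mult_exp_exp)

lemma density_eq: "gumbel_density (fact (m - 1)) x = mu x * exp (- mu x)"
  by (simp add: gumbel_density_def mu_def)

lemma nn_integral_gumbel:
  assumes "f \<in> borel_measurable borel"
  shows "(\<integral>\<^sup>+x. f x \<partial>gumbel (- ln (fact (m - 1))) 1) = (\<integral>\<^sup>+x. ennreal (mu x * exp (- mu x)) * f x \<partial>lborel)"
proof -
  have "gumbel (- ln (fact (m - 1))) 1 = density lborel (\<lambda>x. ennreal (gumbel_density (fact (m - 1)) x))"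
    by (rule gumbel_eq_density) simp
  then show ?thesis
    using assms by (simp add: nn_integral_density density_eq[symmetric])
qed

lemma density_total: "(\<integral>\<^sup>+x. ennreal (mu x * exp (- mu x)) \<partial>lborel) = 1"
proof -
  interpret real_distribution "gumbel (- ln (fact (m - 1))) 1"
    by (rule real_distribution_gumbel) simp
  show ?thesis
    using nn_integral_gumbel[of "\<lambda>_. 1"] emeasure_space_1 by simp
qed

text \<open>
  If at every position \<open>x\<close> the restriction to \<open>P\<close> does not diminish the local limit, then Fatou's lemma
  yields the full mass of the Gumbel law as a lower bound for the probability of \<open>P\<close>.
\<close>

lemma num_tons_probability_tendsto_1:
  assumes local: "\<And>x. \<exists>L. L \<longlonglongrightarrow> mu x * exp (- mu x) \<and>
      (\<forall>\<^sub>F i in sequentially. L i \<le> n i * completes_with i (draws x i) P)"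
  shows "(\<lambda>i. \<P>(\<omega> in M i. P (num_tons m (n i) (X i) (k i) \<omega>))) \<longlonglongrightarrow> 1"
proof -
  let ?p = "\<lambda>i. \<P>(\<omega> in M i. P (num_tons m (n i) (X i) (k i) \<omega>))"
  have "1 = (\<integral>\<^sup>+x. ennreal (mu x * exp (- mu x)) \<partial>lborel)"
    by (rule density_total[symmetric])
  also have "\<dots> \<le> liminf (\<lambda>i. \<Sum>t. ennreal (completes_with i t P))"
  proof (rule fatou_local_to_global[OF n_pos centre_lim])
    fix x
    obtain L where L: "L \<longlonglongrightarrow> mu x * exp (- mu x)" "\<forall>\<^sub>F i in sequentially. L i \<le> n i * completes_with i (draws x i) P"
      using local by blast
    show "ennreal (mu x * exp (- mu x)) \<le> liminf (\<lambda>i. ennreal (n i) * ennreal (completes_with i (nat \<lfloor>n i * (centre i + x)\<rfloor>) P))"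
      using liminf_ennreal_ge[OF L] unfolding draws_def by (simp add: ennreal_mult)
  qed
  also have "\<dots> \<le> liminf (\<lambda>i. ennreal (?p i))"
  proof (intro Liminf_mono always_eventually allI)
    fix i
    interpret coupon "M i" "n i" "X i" by (rule coupon)
    have "(\<Sum>t. ennreal (completes_with i t P)) =
      (\<Sum>t. \<integral>\<^sup>+\<omega>. indicator {\<omega>\<in>space (M i). P (num_tons m (n i) (X i) (k i) \<omega>)} \<omega> * indicator {\<omega>\<in>space (M i). completes m t \<omega>} \<omega> \<partial>M i)"
    proof (intro suminf_cong)
      fix t
      have "(\<integral>\<^sup>+\<omega>. indicator {\<omega>\<in>space (M i). P (num_tons m (n i) (X i) (k i) \<omega>)} \<omega> * indicator {\<omega>\<in>space (M i). completes m t \<omega>} \<omega> \<partial>M i) =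
        (\<integral>\<^sup>+\<omega>. indicator {\<omega>\<in>space (M i). completes m t \<omega> \<and> P (num_tons m (n i) (X i) (k i) \<omega>)} \<omega> \<partial>M i)"
        by (intro nn_integral_cong) (auto simp: indicator_def)
      then show "ennreal (completes_with i t P) = (\<integral>\<^sup>+\<omega>. indicator {\<omega>\<in>space (M i). P (num_tons m (n i) (X i) (k i) \<omega>)} \<omega> * indicator {\<omega>\<in>space (M i). completes m t \<omega>} \<omega> \<partial>M i)"
        by (simp add: emeasure_eq_measure)
    qed
    also have "\<dots> \<le> (\<integral>\<^sup>+\<omega>. indicator {\<omega>\<in>space (M i). P (num_tons m (n i) (X i) (k i) \<omega>)} \<omega> \<partial>M i)"
      by (rule sum_completes_le[OF m_ge_1]) measurable
    also have "\<dots> = ennreal (?p i)"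
      by (simp add: emeasure_eq_measure)
    finally show "(\<Sum>t. ennreal (completes_with i t P)) \<le> ennreal (?p i)" .
  qed
  finally have liminf: "ennreal 1 \<le> liminf (\<lambda>i. ennreal (?p i))" by simp
  show ?thesis
  proof (rule order_tendstoI)
    fix y :: real assume "y < 1"
    then show "\<forall>\<^sub>F i in sequentially. y < ?p i"
      by (intro eventually_gt_of_liminf[OF liminf]) auto
  next
    fix y :: real assume "1 < y"
    have "?p i \<le> 1" for i
    proof -
      interpret coupon "M i" "n i" "X i" by (rule coupon)
      show ?thesis by simp
    qed
    then show "\<forall>\<^sub>F i in sequentially. ?p i < y"
      using \<open>1 < y\<close> by (intro always_eventually allI) (meson le_less_trans)
  qed
qed

theorem no_tons:
  assumes "filterlim \<delta> at_top sequentially"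
  shows "(\<lambda>i. \<P>(\<omega> in M i. num_tons m (n i) (X i) (k i) \<omega> = 0)) \<longlonglongrightarrow> 1"
proof (rule num_tons_probability_tendsto_1[where P = "\<lambda>S. S = 0"])
  fix x
  have "(\<lambda>i. exp (- \<delta> i)) \<longlonglongrightarrow> 0"
    using assms by (intro filterlim_compose[OF exp_at_bot] filterlim_compose[OF filterlim_uminus_at_bot_at_top])
  from mean_tons_limit[OF this, of x] have "(\<lambda>i. mean_tons i (draws x i)) \<longlonglongrightarrow> 0" by simp
  from local_limit_bounded[OF window_conditions this, of 0]
  show "\<exists>L. L \<longlonglongrightarrow> mu x * exp (- mu x) \<and> (\<forall>\<^sub>F i in sequentially. L i \<le> n i * completes_with i (draws x i) (\<lambda>S. S = 0))"
    by (intro exI[of _ "\<lambda>i. n i * completes_with i (draws x i) (\<lambda>S. S = 0)"]) simp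
qed

theorem some_tons:
  assumes "filterlim (\<lambda>i. - \<delta> i) at_top sequentially"
  shows "(\<lambda>i. \<P>(\<omega> in M i. num_tons m (n i) (X i) (k i) \<omega> = 0)) \<longlonglongrightarrow> 0"
proof -
  have "(\<lambda>i. \<P>(\<omega> in M i. num_tons m (n i) (X i) (k i) \<omega> > 0)) \<longlonglongrightarrow> 1"
  proof (rule num_tons_probability_tendsto_1)
    fix x
    have "filterlim (\<lambda>i. (mean_tons i (draws x i) * exp (\<delta> i)) * exp (- \<delta> i)) at_top sequentially"
      by (rule filterlim_tendsto_pos_mult_at_top[OF mean_tons_asymptotics _ filterlim_compose[OF exp_at_top assms]]) simp
    then have "filterlim (\<lambda>i. mean_tons i (draws x i)) at_top sequentially"
      by (simp add: mult.assoc mult_exp_exp)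
    then show "\<exists>L. L \<longlonglongrightarrow> mu x * exp (- mu x) \<and> (\<forall>\<^sub>F i in sequentially. L i \<le> n i * completes_with i (draws x i) (\<lambda>S. 0 < S))"
      by (rule local_limit_unbounded[OF window_conditions])
  qed
  then have "(\<lambda>i. 1 - \<P>(\<omega> in M i. num_tons m (n i) (X i) (k i) \<omega> > 0)) \<longlonglongrightarrow> 1 - 1"
    by (intro tendsto_intros)
  moreover have "1 - \<P>(\<omega> in M i. num_tons m (n i) (X i) (k i) \<omega> > 0) = \<P>(\<omega> in M i. num_tons m (n i) (X i) (k i) \<omega> = 0)" for i
  proof -
    interpret coupon "M i" "n i" "X i" by (rule coupon)
    show ?thesis by (subst prob_neg[symmetric]) (auto simp: neq0_conv)
  qed
  ultimately show ?thesis by simp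
qed

definition time_tons :: "nat \<Rightarrow> 'a \<Rightarrow> real \<times> real" where
  "time_tons i \<omega> = ((real (stop_time m (n i) (X i) \<omega>) - real (n i) * ln (n i) - (real m - 1) * real (n i) * ln (ln (n i))) / real (n i),
      real (num_tons m (n i) (X i) (k i) \<omega>))"

lemma time_tons_eq: "time_tons i \<omega> = (real (stop_time m (n i) (X i) \<omega>) / n i - centre i, real (num_tons m (n i) (X i) (k i) \<omega>))"
  using n_pos[of i] by (simp add: time_tons_def centre_def field_simps)

lemma measurable_time_tons [measurable]: "time_tons i \<in> borel_measurable (M i)"
proof -
  interpret coupon "M i" "n i" "X i" by (rule coupon)
  show ?thesis unfolding time_tons_eq[abs_def] by measurable
qed

text \<open>
  Fatou's lemma is applied twice to the local limit: to the sum over the number \<open>s\<close> of \<open>k\<close>-tons, and to the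
  integral over the position \<open>x\<close>. The stopping time is one more than the number \<open>t\<close> of draws before the
  last, which shifts its normalised value by \<open>1/n\<close>.
\<close>

theorem joint_limit:
  assumes \<delta>: "\<delta> \<longlonglongrightarrow> d"
  shows "weakly_converges (\<lambda>i. distr (M i) borel (time_tons i))
     (mixed_poisson (gumbel (- ln (fact (m - 1))) 1) (\<lambda>x. exp ((exp 1 - 1) * x - d) / sqrt (2 * pi * exp 1)))"
proof -
  define r where "r x = exp ((exp 1 - 1) * x - d) / sqrt (2 * pi * exp 1)" for x
  have r: "r \<in> borel_measurable borel" "\<And>x. r x > 0"
    by (simp_all add: r_def[abs_def])
  have G: "real_distribution (gumbel (- ln (fact (m - 1))) 1)"
    by (rule real_distribution_gumbel) simp
  have mean: "(\<lambda>i. mean_tons i (draws x i)) \<longlonglongrightarrow> r x" for x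
  proof -
    have "(\<lambda>i. exp (- \<delta> i)) \<longlonglongrightarrow> exp (- d)" by (intro tendsto_intros \<delta>)
    from mean_tons_limit[OF this, of x] show ?thesis
      by (simp add: r_def exp_diff exp_minus divide_inverse mult_ac)
  qed
  have "weakly_converges (\<lambda>i. distr (M i) borel (time_tons i)) (mixed_poisson (gumbel (- ln (fact (m - 1))) 1) r)"
  proof (rule weakly_convergesI_liminf)
    fix i
    interpret coupon "M i" "n i" "X i" by (rule coupon)
    show "prob_space (distr (M i) borel (time_tons i))" by (rule prob_space_distr) measurable
  next
    show "prob_space (mixed_poisson (gumbel (- ln (fact (m - 1))) 1) r)"
      "sets (mixed_poisson (gumbel (- ln (fact (m - 1))) 1) r) = sets borel"
      by (rule prob_space_mixed_poisson[OF G r])+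
  next
    fix f :: "real \<times> real \<Rightarrow> real" assume cont: "continuous_on UNIV f" and f0: "\<And>z. f z \<ge> 0"
    have f [measurable]: "f \<in> borel_measurable borel"
      using cont by (rule borel_measurable_continuous_onI)
    define w where "w i t = (\<Sum>s. ennreal (f ((real t + 1) / n i - centre i, real s)) * ennreal (completes_with i t (\<lambda>S. S = s)))" for i t
    define \<phi> where "\<phi> x s = r x ^ s / fact s * exp (- r x)" for x s
    have \<phi>0: "\<phi> x s \<ge> 0" for x s using r(2)[of x] by (simp add: \<phi>_def)
    have ennreal_products: "ennreal a * (ennreal b * ennreal c) = ennreal (c * (a * b))"
      if "a \<ge> 0" "b \<ge> 0" "c \<ge> 0" for a b c :: real
      using that by (simp add: ennreal_mult mult_ac)
    have mu0: "mu x * exp (- mu x) \<ge> 0" for x by (simp add: mu_def)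
    have "(\<integral>\<^sup>+z. ennreal (f z) \<partial>mixed_poisson (gumbel (- ln (fact (m - 1))) 1) r) =
       (\<integral>\<^sup>+x. ennreal (mu x * exp (- mu x)) * (\<Sum>s. ennreal (\<phi> x s) * ennreal (f (x, real s))) \<partial>lborel)"
    proof -
      have meas: "(\<lambda>x. \<Sum>s. ennreal (\<phi> x s) * ennreal (f (x, real s))) \<in> borel_measurable borel"
        using r(1) unfolding \<phi>_def by measurable
      have "(\<integral>\<^sup>+z. ennreal (f z) \<partial>mixed_poisson (gumbel (- ln (fact (m - 1))) 1) r) =
          (\<integral>\<^sup>+x. (\<Sum>s. ennreal (\<phi> x s) * ennreal (f (x, real s))) \<partial>gumbel (- ln (fact (m - 1))) 1)"
        unfolding \<phi>_def by (rule nn_integral_mixed_poisson[OF G r]) measurable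
      then show ?thesis
        by (simp only: nn_integral_gumbel[OF meas])
    qed
    also have "\<dots> \<le> liminf (\<lambda>i. \<Sum>t. w i t)"
    proof (rule fatou_local_to_global[OF n_pos centre_lim])
      fix x
      let ?z = "\<lambda>i. (real (draws x i) + 1) / n i - centre i"
      let ?q = "\<lambda>i s. f (?z i, real s) * (n i * completes_with i (draws x i) (\<lambda>S. S = s))"
      have "(\<lambda>i. (real (draws x i) / n i - centre i) + 1 / n i) \<longlonglongrightarrow> x + 0"
        by (intro tendsto_add draws_lim filterlim_compose[OF _ n_lim, of "\<lambda>n. 1 / real n"]) real_asymp
      then have z: "?z \<longlonglongrightarrow> x" by (simp add: add_divide_distrib algebra_simps)
      have q: "(\<lambda>i. ?q i s) \<longlonglongrightarrow> f (x, real s) * (mu x * exp (- mu x) * \<phi> x s)" for s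
      proof (rule tendsto_mult)
        have "isCont f (x, real s)" using cont by (simp add: continuous_on_eq_continuous_at)
        then show "(\<lambda>i. f (?z i, real s)) \<longlonglongrightarrow> f (x, real s)"
          by (rule isCont_tendsto_compose) (intro tendsto_Pair z tendsto_const)
        show "(\<lambda>i. n i * completes_with i (draws x i) (\<lambda>S. S = s)) \<longlonglongrightarrow> mu x * exp (- mu x) * \<phi> x s"
          unfolding \<phi>_def by (rule local_limit_bounded[OF window_conditions mean])
      qed
      have "ennreal (mu x * exp (- mu x)) * (\<Sum>s. ennreal (\<phi> x s) * ennreal (f (x, real s))) =
          (\<integral>\<^sup>+s. ennreal (f (x, real s) * (mu x * exp (- mu x) * \<phi> x s)) \<partial>count_space UNIV)"
        unfolding nn_integral_count_space_nat ennreal_suminf_cmult[symmetric]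
        by (intro suminf_cong ennreal_products mu0 \<phi>0 f0)
      also have "\<dots> \<le> (\<integral>\<^sup>+s. liminf (\<lambda>i. ennreal (?q i s)) \<partial>count_space UNIV)"
        by (intro nn_integral_mono liminf_ennreal_ge[OF q]) simp
      also have "\<dots> \<le> liminf (\<lambda>i. \<integral>\<^sup>+s. ennreal (?q i s) \<partial>count_space UNIV)"
        by (intro nn_integral_liminf) simp
      also have "(\<lambda>i. \<integral>\<^sup>+s. ennreal (?q i s) \<partial>count_space UNIV) = (\<lambda>i. ennreal (n i) * w i (draws x i))"
        unfolding nn_integral_count_space_nat w_def ennreal_suminf_cmult[symmetric]
        by (intro ext suminf_cong) (subst mult.commute[of "ennreal (f _)"], intro ennreal_products[symmetric] f0, simp_all)
      finally show "ennreal (mu x * exp (- mu x)) * (\<Sum>s. ennreal (\<phi> x s) * ennreal (f (x, real s))) \<le>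
          liminf (\<lambda>i. ennreal (n i) * w i (nat \<lfloor>n i * (centre i + x)\<rfloor>))"
        unfolding draws_def .
    qed
    also have "\<dots> \<le> liminf (\<lambda>i. \<integral>\<^sup>+z. ennreal (f z) \<partial>distr (M i) borel (time_tons i))"
    proof (intro Liminf_mono always_eventually allI)
      fix i
      interpret coupon "M i" "n i" "X i" by (rule coupon)
      have "w i t = (\<integral>\<^sup>+\<omega>. ennreal (f (time_tons i \<omega>)) * indicator {\<omega>\<in>space (M i). completes m t \<omega>} \<omega> \<partial>M i)" for t
        unfolding w_def nn_integral_completes_num_tons[symmetric]
        by (intro nn_integral_cong) (auto simp: indicator_def time_tons_eq stop_time_completes[OF m_ge_1] add.commute)
      then have "(\<Sum>t. w i t) \<le> (\<integral>\<^sup>+\<omega>. ennreal (f (time_tons i \<omega>)) \<partial>M i)"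
        by (simp only:) (rule sum_completes_le[OF m_ge_1], measurable)
      also have "\<dots> = (\<integral>\<^sup>+z. ennreal (f z) \<partial>distr (M i) borel (time_tons i))"
        by (rule nn_integral_distr[symmetric]) measurable
      finally show "(\<Sum>t. w i t) \<le> (\<integral>\<^sup>+z. ennreal (f z) \<partial>distr (M i) borel (time_tons i))" .
    qed
    finally show "(\<integral>\<^sup>+z. ennreal (f z) \<partial>mixed_poisson (gumbel (- ln (fact (m - 1))) 1) r) \<le>
      liminf (\<lambda>i. \<integral>\<^sup>+z. ennreal (f z) \<partial>distr (M i) borel (time_tons i))" .
  qed simp
  then show ?thesis unfolding r_def[abs_def] .
qed

end

theorem theorem1p2:
  fixes m :: nat
    and M :: "nat \<Rightarrow> 'a measure"
    and X :: "nat \<Rightarrow> nat \<Rightarrow> 'a \<Rightarrow> nat"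
  assumes "m \<ge> 1"
    and "\<And>n. n \<ge> 2 \<Longrightarrow> coupon_process (M n) n (X n)"
  shows
    "(\<forall>(d :: real) (n :: nat \<Rightarrow> nat) (\<delta> :: nat \<Rightarrow> real) (k :: nat \<Rightarrow> nat).
        strict_mono n \<longrightarrow> (\<forall>j. n j \<ge> 2) \<longrightarrow> \<delta> \<longlonglongrightarrow> d \<longrightarrow>
        (\<forall>j. k j > 0 \<and>
           real (k j) = exp 1 * ln (n j)
             + ((exp 1 - 1) * (real m - 1) - 1 / 2) * ln (ln (n j)) + \<delta> j) \<longrightarrow>
        weakly_converges
          (\<lambda>j. distr (M (n j)) borel
             (\<lambda>\<omega>. ((real (stop_time m (n j) (X (n j)) \<omega>) - real (n j) * ln (n j)
                      - (real m - 1) * real (n j) * ln (ln (n j))) / real (n j),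
                    real (num_tons m (n j) (X (n j)) (k j) \<omega>))))
          (mixed_poisson (gumbel (- ln (fact (m - 1))) 1)
             (\<lambda>x. exp ((exp 1 - 1) * x - d) / sqrt (2 * pi * exp 1))))
     \<and>
     (\<forall>(g :: nat \<Rightarrow> real) (k :: nat \<Rightarrow> nat).
        g \<in> o(\<lambda>n. ln (ln (real n))) \<longrightarrow> filterlim g at_top sequentially \<longrightarrow>
        (\<forall>n\<ge>2. k n > 0 \<and>
           real (k n) = exp 1 * ln n
             + ((exp 1 - 1) * (real m - 1) - 1 / 2) * ln (ln n) + g n) \<longrightarrow>
        (\<lambda>n. measure (M n) {\<omega> \<in> space (M n). num_tons m n (X n) (k n) \<omega> = 0}) \<longlonglongrightarrow> 1)
     \<and>
     (\<forall>(g :: nat \<Rightarrow> real) (k :: nat \<Rightarrow> nat).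
        g \<in> o(\<lambda>n. ln (ln (real n))) \<longrightarrow> filterlim g at_top sequentially \<longrightarrow>
        (\<forall>n\<ge>2. k n > 0 \<and>
           real (k n) = exp 1 * ln n
             + ((exp 1 - 1) * (real m - 1) - 1 / 2) * ln (ln n) - g n) \<longrightarrow>
        (\<lambda>n. measure (M n) {\<omega> \<in> space (M n). num_tons m n (X n) (k n) \<omega> = 0}) \<longlonglongrightarrow> 0)"
proof (intro conjI allI impI)
  fix d :: real and n :: "nat \<Rightarrow> nat" and \<delta> :: "nat \<Rightarrow> real" and k :: "nat \<Rightarrow> nat"
  assume mono: "strict_mono n" and n2: "\<forall>j. n j \<ge> 2" and \<delta>: "\<delta> \<longlonglongrightarrow> d"
    and k: "\<forall>j. k j > 0 \<and> real (k j) = exp 1 * ln (n j) + ((exp 1 - 1) * (real m - 1) - 1 / 2) * ln (ln (n j)) + \<delta> j"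
  have n_lim: "filterlim n at_top sequentially"
    using mono by (rule filterlim_subseq)
  interpret critical_coupons "\<lambda>j. M (n j)" n "\<lambda>j. X (n j)" m k \<delta>
  proof (rule critical_coupons.intro)
    show "coupon (M (n j)) (n j) (X (n j))" for j
      using assms(2) n2 by (intro coupon_process_imp_coupon) auto
    have "(\<lambda>j. 1 / ln (ln (real (n j)))) \<longlonglongrightarrow> 0"
      by (rule filterlim_compose[OF _ n_lim]) real_asymp
    from tendsto_mult[OF \<delta> this] show "(\<lambda>j. \<delta> j / ln (ln (n j))) \<longlonglongrightarrow> 0" by simp
  qed (use assms(1) k n_lim in auto)
  show "weakly_converges
          (\<lambda>j. distr (M (n j)) borel
             (\<lambda>\<omega>. ((real (stop_time m (n j) (X (n j)) \<omega>) - real (n j) * ln (n j)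
                      - (real m - 1) * real (n j) * ln (ln (n j))) / real (n j),
                    real (num_tons m (n j) (X (n j)) (k j) \<omega>))))
          (mixed_poisson (gumbel (- ln (fact (m - 1))) 1)
             (\<lambda>x. exp ((exp 1 - 1) * x - d) / sqrt (2 * pi * exp 1)))"
    using joint_limit[OF \<delta>] unfolding time_tons_def[abs_def] .
next
  fix g :: "nat \<Rightarrow> real" and k :: "nat \<Rightarrow> nat"
  assume g: "g \<in> o(\<lambda>n. ln (ln (real n)))" and g_lim: "filterlim g at_top sequentially"
    and k: "\<forall>n\<ge>2. k n > 0 \<and> real (k n) = exp 1 * ln n + ((exp 1 - 1) * (real m - 1) - 1 / 2) * ln (ln n) + g n"
  \<comment> \<open>The processes and the formula for \<open>k\<close> are given for \<open>n \<ge> 2\<close> only, hence the shift by 2.\<close>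
  interpret critical_coupons "\<lambda>j. M (j + 2)" "\<lambda>j. j + 2" "\<lambda>j. X (j + 2)" m "\<lambda>j. k (j + 2)" "\<lambda>j. g (j + 2)"
  proof (rule critical_coupons.intro)
    show "coupon (M (j + 2)) (j + 2) (X (j + 2))" for j
      by (intro coupon_process_imp_coupon assms) auto
    show "filterlim (\<lambda>j. j + 2) at_top sequentially" by (rule filterlim_add_const_nat_at_top)
    show "(\<lambda>j. g (j + 2) / ln (ln (real (j + 2)))) \<longlonglongrightarrow> 0"
      by (rule LIMSEQ_ignore_initial_segment[OF smalloD_tendsto[OF g]])
    show "real (k (j + 2)) = exp 1 * ln (real (j + 2)) + ((exp 1 - 1) * (real m - 1) - 1 / 2) * ln (ln (real (j + 2))) + g (j + 2)" for j
      using k by auto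
  qed (rule assms(1))
  have "filterlim (\<lambda>j. g (j + 2)) at_top sequentially"
    by (rule filterlim_compose[OF g_lim filterlim_add_const_nat_at_top])
  from no_tons[OF this] show "(\<lambda>n. measure (M n) {\<omega> \<in> space (M n). num_tons m n (X n) (k n) \<omega> = 0}) \<longlonglongrightarrow> 1"
    by (rule LIMSEQ_offset)
next
  fix g :: "nat \<Rightarrow> real" and k :: "nat \<Rightarrow> nat"
  assume g: "g \<in> o(\<lambda>n. ln (ln (real n)))" and g_lim: "filterlim g at_top sequentially"
    and k: "\<forall>n\<ge>2. k n > 0 \<and> real (k n) = exp 1 * ln n + ((exp 1 - 1) * (real m - 1) - 1 / 2) * ln (ln n) - g n"
  interpret critical_coupons "\<lambda>j. M (j + 2)" "\<lambda>j. j + 2" "\<lambda>j. X (j + 2)" m "\<lambda>j. k (j + 2)" "\<lambda>j. - g (j + 2)"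
  proof (rule critical_coupons.intro)
    show "coupon (M (j + 2)) (j + 2) (X (j + 2))" for j
      by (intro coupon_process_imp_coupon assms) auto
    show "filterlim (\<lambda>j. j + 2) at_top sequentially" by (rule filterlim_add_const_nat_at_top)
    show "(\<lambda>j. - g (j + 2) / ln (ln (real (j + 2)))) \<longlonglongrightarrow> 0"
      using tendsto_minus[OF LIMSEQ_ignore_initial_segment[OF smalloD_tendsto[OF g], of 2]] by simp
    show "real (k (j + 2)) = exp 1 * ln (real (j + 2)) + ((exp 1 - 1) * (real m - 1) - 1 / 2) * ln (ln (real (j + 2))) + - g (j + 2)" for j
      using k by auto
  qed (rule assms(1))
  have "filterlim (\<lambda>j. - (- g (j + 2))) at_top sequentially"
    using filterlim_compose[OF g_lim filterlim_add_const_nat_at_top, of 2] by simp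
  from some_tons[OF this] show "(\<lambda>n. measure (M n) {\<omega> \<in> space (M n). num_tons m n (X n) (k n) \<omega> = 0}) \<longlonglongrightarrow> 0"
    by (rule LIMSEQ_offset)
qed

end
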